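(* Let $n\ge 0$ and $t\in\mathbb{F}_2^{n+1}$. If $R(n,t)=S(n)/I_{G_n^t}$ and $\widehat{R(n,t)}\cong R(n,t)/(\overline{X_n})$, we have $$\dim_k\big(\widehat{R(n,t)}\big)_i=\begin{cases}1 & i=0,\\[2pt] \dfrac{1}{i!}\displaystyle\prod_{j=1}^{i}\big(n+j-2(i-1)\big) & i\ge 1.\end{cases}$$ In particular, $\dim_k\big(\widehat{R(n,t)}\big)_i=0$ when $i>n/2+1$.
   Context: Throughout, $k$ is a field. Ladder-like structures. For $n\ge 0$ and $t=(t_1,\dots,t_{n+1})\in\mathbb{F}_2^{n+1}$, $L_n^t$ is a partially filled array with $\lfloor n/2\rfloor+2$ rows (numbered top to bottom) and $\lceil n/2\rceil+2$ columns (numbered left to right); its nonzero entries are the variables $x_0,x_2,x_3,\dots,x_{2n+4}$ (there is no $x_1$), each occurring exactly once, all other positions being empty. It is defined recursively, with $\widehat t=(t_1,\dots,t_n)$: - $L_0^t$ has first row $x_0,x_2$ and second row $x_3,x_4$ (for both values of $t$). - $L_1^t$ has first row $x_0,x_2,x_5$ and second row $x_3,x_4,x_6$ (for all $t$). - For $n\ge 2$ even, $L_n^t$ is $L_{n-1}^{\widehat t}$ with a new bottom row added whose only nonzero entries are $x_{2n+4}$, in the last column, and $x_{2n+3}$, in the column containing the first (if $t_{n+1}=0$) or the second (if $t_{n+1}=1$) nonzero entry, from left to right, of the row immediately above the new row. - For $n\ge 3$ odd, $L_n^t$ is $L_{n-1}^{\widehat t}$ with a new rightmost column added whose only nonzero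 entries are $x_{2n+4}$, in the last row, and $x_{2n+3}$, in the row containing the first (if $t_{n+1}=0$) or the second (if $t_{n+1}=1$) nonzero entry, from top to bottom, of the column immediately to the left of the new column. Graphs and toric rings. $G_n^t$ is the bipartite graph with one vertex for each row and one vertex for each column of $L_n^t$, and, for each nonzero entry $x_j$ of $L_n^t$, one edge (called $x_j$) joining the vertex of its row to the vertex of its column. Let $V$ be its vertex set, $S(n)=k[x_0,x_2,x_3,\dots,x_{2n+4}]$ the polynomial ring on the edges, and $I_{G_n^t}$ (the toric ideal) the kernel of the $k$-algebra homomorphism $S(n)\to k[V]$ sending each edge to the product of its two endpoints. The toric ring is $R(n,t)=S(n)/I_{G_n^t}$, graded with all variables in degree 1. Let $X_n=x_0,\,x_2-x_3,\,x_4-x_5,\ldots,x_{2n+2}-x_{2n+3},\,x_{2n+4}$ and let $\overline{X_n}$ be its image in $R(n,t)$. The graded ring $\widehat{R(n,t)}$ is $R(n,t)/(\overline{X_n})$, identified with $k[x_3,x_5,\dots,x_{2n+3}]/\widehat{I_{G_n^t}}$, where $\widehat{I_{G_n^t}}$ is the image of $I_{G_n^t}$ under the substitution $x_0,x_{2n+4}\mapsto 0$, $x_{2i}\mapsto x_{2i+1}$ for $1\le i\le n+1$ (odd-indexed variables fixed). (It is not a completion.) $(\cdot)_i$ denotes the degree $i$ graded piece.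
   Formalization: The closed product formula is asserted only for i ≤ n+2, since for i ≥ n+3 all its factors are negative and it is nonzero while the graded piece is 0 (n=0, i=3 gives −1); the vanishing of the dimension is proved for all i > n/2+1. *)

theory Defs
  imports
    Complex_Main
    "HOL-Algebra.QuotRing"
    "HOL-Algebra.Embedded_Algebras"
    "HOL-Library.Poly_Mapping"
    "HOL-Library.Z2"
begin

text \<open>
  The ladder-like structure \<open>L_n^t\<close>. The array is a partial map from positions
  (row, column), both counted from 1, to the indices of the variables; \<open>t\<close> is the
  list \<open>[t_1, \<dots>, t_{n+1}]\<close> over \<open>\<F>_2\<close>, so that \<open>butlast t\<close> is the truncation
  and \<open>last t\<close> is \<open>t_{n+1}\<close>.
\<close>

definition ladder_rows :: "nat \<Rightarrow> nat" where
  "ladder_rows n = n div 2 + 2"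

text \<open>Here \<open>(n + 1) div 2\<close> is the ceiling of \<open>n / 2\<close>.\<close>

definition ladder_cols :: "nat \<Rightarrow> nat" where
  "ladder_cols n = (n + 1) div 2 + 2"

fun ladder :: "nat \<Rightarrow> bit list \<Rightarrow> nat \<times> nat \<rightharpoonup> nat" where
  "ladder 0 t = [(1,1) \<mapsto> 0, (1,2) \<mapsto> 2,
                 (2,1) \<mapsto> 3, (2,2) \<mapsto> 4]"
| "ladder (Suc 0) t = [(1,1) \<mapsto> 0, (1,2) \<mapsto> 2, (1,3) \<mapsto> 5,
                       (2,1) \<mapsto> 3, (2,2) \<mapsto> 4, (2,3) \<mapsto> 6]"
| "ladder (Suc (Suc m)) t =
    (let n = m + 2;
         L = ladder (Suc m) (butlast t);
         r = ladder_rows n;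
         c = ladder_cols n;
         k = (if last t = 0 then 0 else 1)
     in if even n
        then let j = filter (\<lambda>j. (r - 1, j) \<in> dom L) [1..<c + 1] ! k
             in L((r, j) \<mapsto> 2 * n + 3, (r, c) \<mapsto> 2 * n + 4)
        else let i = filter (\<lambda>i. (i, c - 1) \<in> dom L) [1..<r + 1] ! k
             in L((i, c) \<mapsto> 2 * n + 3, (r, c) \<mapsto> 2 * n + 4))"

text \<open>Graphs are given by their vertices, their edges and the set of endpoints of each edge.\<close>

record ('v, 'e) edge_graph =
  verts :: "'v set"
  edges :: "'e set"
  ends :: "'e \<Rightarrow> 'v set"

text \<open>In \<open>G_n^t\<close>, \<open>Inl i\<close> is the vertex of row \<open>i\<close> and \<open>Inr j\<close> is the vertex of column \<open>j\<close>.\<close>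

definition G_graph :: "nat \<Rightarrow> bit list \<Rightarrow> (nat + nat, nat) edge_graph" where
  "G_graph n t =
    \<lparr> verts = Inl ` {1..ladder_rows n} \<union> Inr ` {1..ladder_cols n},
      edges = ran (ladder n t),
      ends = (\<lambda>x. {Inl i | i j. ladder n t (i, j) = Some x} \<union>
                  {Inr j | i j. ladder n t (i, j) = Some x}) \<rparr>"

text \<open>
  Polynomials in variables of type \<open>'v\<close> are finitely supported maps from monomials,
  i.e. finitely supported exponent vectors, to coefficients.
\<close>

type_synonym ('v, 'k) mpol = "('v \<Rightarrow>\<^sub>0 nat) \<Rightarrow>\<^sub>0 'k"

definition const :: "'k::field \<Rightarrow> ('v, 'k) mpol" where
  "const c = Poly_Mapping.single 0 c"

definition var :: "'v \<Rightarrow> ('v, 'k::field) mpol" where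
  "var v = Poly_Mapping.single (Poly_Mapping.single v 1) 1"

definition poly_ring :: "'v set \<Rightarrow> ('v, 'k::field) mpol ring" where
  "poly_ring X =
    \<lparr> carrier = {p. \<forall>m \<in> Poly_Mapping.keys p. Poly_Mapping.keys m \<subseteq> X},
      monoid.mult = (*), one = 1, zero = 0, add = (+) \<rparr>"

definition homogeneous :: "nat \<Rightarrow> ('v, 'k::field) mpol \<Rightarrow> bool" where
  "homogeneous d p \<longleftrightarrow>
    (\<forall>m \<in> Poly_Mapping.keys p. (\<Sum>v \<in> Poly_Mapping.keys m. Poly_Mapping.lookup m v) = d)"

text \<open>The \<open>k\<close>-algebra homomorphism sending each variable \<open>v\<close> to \<open>f v\<close>.\<close>

definition poly_subst :: "('v \<Rightarrow> ('w, 'k::field) mpol) \<Rightarrow> ('v, 'k) mpol \<Rightarrow> ('w, 'k) mpol" where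
  "poly_subst f p =
    (\<Sum>m \<in> Poly_Mapping.keys p. const (Poly_Mapping.lookup p m) *
       (\<Prod>v \<in> Poly_Mapping.keys m. f v ^ Poly_Mapping.lookup m v))"

definition toric_ideal :: "('v, 'e) edge_graph \<Rightarrow> ('e, 'k::field) mpol set" where
  "toric_ideal G =
    a_kernel (poly_ring (edges G)) (poly_ring (verts G))
      (poly_subst (\<lambda>e. \<Prod>v \<in> ends G e. var v))"

text \<open>
  The variables \<open>x_0, x_2, x_3, \<dots>, x_{2n+4}\<close> of \<open>S(n)\<close> are the entries of
  \<open>L_n^t\<close>, that is, the edges of \<open>G_n^t\<close>.
\<close>

definition S_ring :: "nat \<Rightarrow> (nat, 'k::field) mpol ring" where
  "S_ring n = poly_ring (insert 0 {2..2 * n + 4})"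

definition R_ring :: "nat \<Rightarrow> bit list \<Rightarrow> (nat, 'k::field) mpol set ring" where
  "R_ring n t = S_ring n Quot toric_ideal (G_graph n t)"

definition R_class :: "nat \<Rightarrow> bit list \<Rightarrow> (nat, 'k::field) mpol \<Rightarrow> (nat, 'k) mpol set" where
  "R_class n t p = toric_ideal (G_graph n t) +>\<^bsub>S_ring n\<^esub> p"

definition X_seq :: "nat \<Rightarrow> (nat, 'k::field) mpol set" where
  "X_seq n = {var 0, var (2 * n + 4)} \<union> {var (2 * i) - var (2 * i + 1) | i. i \<in> {1..n + 1}}"

definition X_ideal :: "nat \<Rightarrow> bit list \<Rightarrow> (nat, 'k::field) mpol set set" where
  "X_ideal n t = Idl\<^bsub>R_ring n t\<^esub> (R_class n t ` X_seq n)"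

definition Rhat :: "nat \<Rightarrow> bit list \<Rightarrow> (nat, 'k::field) mpol set set ring" where
  "Rhat n t = R_ring n t Quot X_ideal n t"

definition Rhat_class :: "nat \<Rightarrow> bit list \<Rightarrow> (nat, 'k::field) mpol \<Rightarrow> (nat, 'k) mpol set set" where
  "Rhat_class n t p = X_ideal n t +>\<^bsub>R_ring n t\<^esub> R_class n t p"

text \<open>The copy of \<open>k\<close> inside \<open>Rhat n t\<close>, over which dimensions are taken.\<close>

definition Rhat_scalars :: "nat \<Rightarrow> bit list \<Rightarrow> (nat, 'k::field) mpol set set set" where
  "Rhat_scalars n t = Rhat_class n t ` range const"

definition Rhat_piece :: "nat \<Rightarrow> bit list \<Rightarrow> nat \<Rightarrow> (nat, 'k::field) mpol set set set" where
  "Rhat_piece n t i = Rhat_class n t ` {p \<in> carrier (S_ring n). homogeneous i p}"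

end

theory Submission
  imports Defs "HOL-Library.Multiset"
begin

text \<open>
  Number the vertices of the graph \<open>w_0, w_1, w_2, \<dots>\<close> in the order column 1, row 1, column 2, row 2, and so
  on. The even variables then form a path, \<open>x_{2i}\<close> joining \<open>w_i\<close> to \<open>w_{i+1}\<close>, and \<open>x_{2i+1}\<close> joins
  \<open>w_{i+2}\<close> to an earlier vertex \<open>w_{U i}\<close>. The whole effect of \<open>t\<close> is that \<open>U i\<close> is either \<open>i - 1\<close> or
  \<open>U (i - 2)\<close> (\<open>ladder_cell\<close>). This makes both \<open>w_{U i} w_i\<close> and \<open>w_{U i} w_{U (i+1)}\<close> edges, so there are
  4-cycles, and with them binomials \<open>x_{2i} x_{2i+1} - x_a x_{2i+2}\<close> and
  \<open>x_{2i+1} x_{2i+3} - x_b x_{2i+4}\<close> in the toric ideal.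

  Call the elements of \<open>X_n\<close> parameters, and call a set of indices in \<open>{1..n+1}\<close> sparse if it contains no two
  consecutive numbers. The claim is that the toric ring is a free module over the polynomial ring in
  the parameters, with basis the products of the \<open>x_{2i+1}\<close> over sparse sets.

  These products generate (\<open>psi_monomial_in_graded_span\<close>): modulo the parameters \<open>x_{2i}\<close> equals
  \<open>x_{2i+1}\<close>, so by the binomials a square \<open>x_{2i+1}^2\<close> or a product \<open>x_{2i+1} x_{2i+3}\<close> can be traded for a
  product that involves a later even variable. This terminates because the weight \<open>3^j\<close> of the
  variable \<open>x_j\<close> makes every such step increase the weight in a fixed degree.

  They are independent by counting (\<open>bounded_independent\<close>). Call a monomial standard if no
  \<open>x_{2i} x_{2i+1}\<close> and no \<open>x_{2i+1} x_{2i+3}\<close> divides it. A standard monomial is determined by its vertex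
  degrees, since the exponents of the two edges at the last vertex can be read off and peeled away
  (\<open>standard_eqI\<close>); hence the toric map sends distinct standard monomials to distinct monomials. The
  squarefree products \<open>x_{2i} x_{2i+1}\<close>, \<open>x_{2i+1} x_{2i+3}\<close> are the polarizations of \<open>x_{2i+1}^2\<close>,
  \<open>x_{2i+1} x_{2i+3}\<close>, so standard monomials of degree \<open>d\<close> correspond to pairs of a monomial in the
  parameters and a sparse set of total degree \<open>d\<close> (\<open>standard_of\<close>). Thus in degrees up to \<open>D\<close> a finite
  spanning family is no larger than an independent set inside its span, and is therefore a basis.

  Dividing out the parameters leaves the products over sparse sets of size \<open>i\<close> as a basis of degree \<open>i\<close>,
  and there are \<open>n + 2 - i\<close> choose \<open>i\<close> of them.
\<close>

section \<open>The ladder as a graph\<close>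

text \<open>
  \<open>U i\<close> is the number of the earlier endpoint of the edge \<open>x_{2i+1}\<close>. The two alternatives are the
  two values of the bit that places this edge; for \<open>i\<close> at most 2 there is no choice.
\<close>

definition attachment :: "nat \<Rightarrow> (nat \<Rightarrow> nat) \<Rightarrow> bool" where
  "attachment n U \<longleftrightarrow> (\<forall>i\<in>{1..n + 1}. U i = i - 1 \<or> 3 \<le> i \<and> U i = U (i - 2))"

lemma attachmentD:
  assumes "attachment n U" "1 \<le> i" "i \<le> n + 1"
  shows "U i = i - 1 \<or> 3 \<le> i \<and> U i = U (i - 2)"
  using assms by (simp add: attachment_def)

lemma attachment_less:
  assumes "attachment n U" "1 \<le> i" "i \<le> n + 1"
  shows "U i < i"
  using assms(2,3)
proof (induction i rule: less_induct)
  case (less i)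
  from attachmentD[OF assms(1) less.prems] show ?case
  proof
    assume "3 \<le> i \<and> U i = U (i - 2)"
    moreover from this have "U (i - 2) < i - 2" using less.IH[of "i - 2"] less.prems by linarith
    ultimately show ?thesis by linarith
  qed (use less.prems in simp)
qed

text \<open>
  Rows have odd and columns even numbers, so this says that the edge \<open>x_{2i+1}\<close>, which ends in
  vertex \<open>i + 2\<close>, respects the bipartition.
\<close>

lemma attachment_parity:
  assumes "attachment n U" "1 \<le> i" "i \<le> n + 1"
  shows "even (U i) \<longleftrightarrow> odd i"
  using assms(2,3)
proof (induction i rule: less_induct)
  case (less i)
  from attachmentD[OF assms(1) less.prems] show ?case
  proof
    assume *: "3 \<le> i \<and> U i = U (i - 2)"
    moreover from this have "even (U (i - 2)) \<longleftrightarrow> odd (i - 2)"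
      using less.IH[of "i - 2"] less.prems by linarith
    ultimately show ?thesis by simp
  qed (use less.prems in simp)
qed

definition edge_set :: "nat \<Rightarrow> nat set" where
  "edge_set n = insert 0 {2..2 * n + 4}"

lemma even_in_edge_set: "2 * i \<in> edge_set n \<longleftrightarrow> i \<le> n + 2"
  by (auto simp: edge_set_def)

lemma odd_in_edge_set: "2 * i + 1 \<in> edge_set n \<longleftrightarrow> 1 \<le> i \<and> i \<le> n + 1"
  by (auto simp: edge_set_def)

lemma edge_set_cases:
  assumes "x \<in> edge_set n"
  obtains i where "x = 2 * i" "i \<le> n + 2" | i where "x = 2 * i + 1" "1 \<le> i" "i \<le> n + 1"
proof (cases "even x")
  case True
  then obtain i where "x = 2 * i" by (rule evenE)
  with assms that(1)[of i] show ?thesis by (simp add: even_in_edge_set)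
next
  case False
  then obtain i where i: "x = 2 * i + 1" by (rule oddE)
  with assms have "1 \<le> i" "i \<le> n + 1" unfolding i odd_in_edge_set by auto
  with i that(2)[of i] show ?thesis by blast
qed

lemma edge_set_Suc: "edge_set (Suc n) = edge_set n \<union> {2 * Suc n + 3, 2 * Suc n + 4}"
  by (auto simp: edge_set_def)

text \<open>
  The cell in which the row and the column with vertex numbers \<open>i\<close> and \<open>j\<close> meet, where one of the two
  numbers is even.
\<close>

definition crossing :: "nat \<Rightarrow> nat \<Rightarrow> nat \<times> nat" where
  "crossing i j = (if even i then (j div 2 + 1, i div 2 + 1) else (i div 2 + 1, j div 2 + 1))"

definition cell :: "(nat \<Rightarrow> nat) \<Rightarrow> nat \<Rightarrow> nat \<times> nat" where
  "cell U x = (if even x then crossing (x div 2) (x div 2 + 1)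
               else crossing (U (x div 2)) (x div 2 + 2))"

lemma cell_even: "cell U (2 * i) = crossing i (i + 1)"
  by (simp add: cell_def)

lemma cell_odd: "cell U (2 * i + 1) = crossing (U i) (i + 2)"
  by (simp add: cell_def)

lemma filter_upt_eq_three:
  assumes "\<And>j. P j \<longleftrightarrow> j = a \<or> j = b \<or> j = d" "l \<le> a" "a < b" "b < d" "d < u"
  shows "filter P [l..<u] = [a, b, d]"
proof (rule sorted_distinct_set_unique)
  show "set (filter P [l..<u]) = set [a, b, d]" using assms by auto
qed (use assms in \<open>auto intro: sorted_wrt_filter\<close>)

text \<open>
  When a row is added, the previous row holds three entries: the two it was created with and the
  lower one of the column added in between. This identifies the candidates for the bit of \<open>t\<close>.
\<close>

lemma last_row:
  assumes U: "attachment (n - 1) U" and n: "even n" "2 \<le> n"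
  shows "(\<exists>x\<in>edge_set (n - 1). cell U x = (n div 2 + 1, j)) \<longleftrightarrow>
         j = U (n - 1) div 2 + 1 \<or> j = n div 2 + 1 \<or> j = n div 2 + 2"
proof
  assume "\<exists>x\<in>edge_set (n - 1). cell U x = (n div 2 + 1, j)"
  then obtain x where x: "x \<in> edge_set (n - 1)" and c: "cell U x = (n div 2 + 1, j)" by blast
  from x show "j = U (n - 1) div 2 + 1 \<or> j = n div 2 + 1 \<or> j = n div 2 + 2"
  proof (cases rule: edge_set_cases)
    case (1 i)
    then have "i \<le> n + 1" using n by auto
    with c n show ?thesis unfolding 1 cell_even
      by (auto simp: crossing_def split: if_splits elim!: evenE oddE)
  next
    case (2 i)
    with attachment_less[OF U, of i] attachment_parity[OF U, of i] n
    have *: "U i < i" "even (U i) \<longleftrightarrow> odd i" "i \<le> n" by auto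
    show ?thesis
    proof (cases "even i")
      case True
      with c * n show ?thesis unfolding 2 cell_odd
        by (auto simp: crossing_def elim!: evenE oddE)
    next
      case False
      with c * n have "i = n - 1" unfolding 2 cell_odd
        by (auto simp: crossing_def elim!: evenE oddE)
      with c * n False show ?thesis unfolding 2 cell_odd
        by (auto simp: crossing_def elim!: evenE oddE)
    qed
  qed
next
  assume "j = U (n - 1) div 2 + 1 \<or> j = n div 2 + 1 \<or> j = n div 2 + 2"
  then consider "j = U (n - 1) div 2 + 1" | "j = n div 2 + 1" | "j = n div 2 + 2" by blast
  then show "\<exists>x\<in>edge_set (n - 1). cell U x = (n div 2 + 1, j)"
  proof cases
    case 1
    have "even (U (n - 1))" using attachment_parity[OF U, of "n - 1"] n by auto
    then have "cell U (2 * (n - 1) + 1) = (n div 2 + 1, j)"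
      unfolding cell_odd using 1 n by (auto simp: crossing_def elim!: evenE)
    moreover have "2 * (n - 1) + 1 \<in> edge_set (n - 1)" unfolding odd_in_edge_set using n by auto
    ultimately show ?thesis by blast
  next
    case 2
    then have "cell U (2 * n) = (n div 2 + 1, j)"
      unfolding cell_even using n by (auto simp: crossing_def)
    moreover have "2 * n \<in> edge_set (n - 1)" unfolding even_in_edge_set by auto
    ultimately show ?thesis by blast
  next
    case 3
    then have "cell U (2 * (n + 1)) = (n div 2 + 1, j)"
      unfolding cell_even using n by (auto simp: crossing_def)
    moreover have "2 * (n + 1) \<in> edge_set (n - 1)" unfolding even_in_edge_set using n by auto
    ultimately show ?thesis by blast
  qed
qed

text \<open>
  The transposed statement, for the step that adds a column.
\<close>

lemma last_col:
  assumes U: "attachment (n - 1) U" and n: "odd n" "2 \<le> n"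
  shows "(\<exists>x\<in>edge_set (n - 1). cell U x = (i, (n + 1) div 2 + 1)) \<longleftrightarrow>
         i = U (n - 1) div 2 + 1 \<or> i = n div 2 + 1 \<or> i = n div 2 + 2"
proof
  assume "\<exists>x\<in>edge_set (n - 1). cell U x = (i, (n + 1) div 2 + 1)"
  then obtain x where x: "x \<in> edge_set (n - 1)" and c: "cell U x = (i, (n + 1) div 2 + 1)" by blast
  from x show "i = U (n - 1) div 2 + 1 \<or> i = n div 2 + 1 \<or> i = n div 2 + 2"
  proof (cases rule: edge_set_cases)
    case (1 k)
    then have "k \<le> n + 1" using n by auto
    with c n show ?thesis unfolding 1 cell_even
      by (auto simp: crossing_def split: if_splits elim!: evenE oddE)
  next
    case (2 k)
    with attachment_less[OF U, of k] attachment_parity[OF U, of k] n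
    have *: "U k < k" "even (U k) \<longleftrightarrow> odd k" "k \<le> n" by auto
    show ?thesis
    proof (cases "odd k")
      case True
      with c * n show ?thesis unfolding 2 cell_odd
        by (auto simp: crossing_def elim!: evenE oddE)
    next
      case False
      with c * n have "k = n - 1" unfolding 2 cell_odd
        by (auto simp: crossing_def elim!: evenE oddE)
      with c * n False show ?thesis unfolding 2 cell_odd
        by (auto simp: crossing_def elim!: evenE oddE)
    qed
  qed
next
  assume "i = U (n - 1) div 2 + 1 \<or> i = n div 2 + 1 \<or> i = n div 2 + 2"
  then consider "i = U (n - 1) div 2 + 1" | "i = n div 2 + 1" | "i = n div 2 + 2" by blast
  then show "\<exists>x\<in>edge_set (n - 1). cell U x = (i, (n + 1) div 2 + 1)"
  proof cases
    case 1
    have "odd (U (n - 1))" using attachment_parity[OF U, of "n - 1"] n by auto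
    then have "cell U (2 * (n - 1) + 1) = (i, (n + 1) div 2 + 1)"
      unfolding cell_odd using 1 n by (auto simp: crossing_def elim!: oddE)
    moreover have "2 * (n - 1) + 1 \<in> edge_set (n - 1)" unfolding odd_in_edge_set using n by auto
    ultimately show ?thesis by blast
  next
    case 2
    then have "cell U (2 * n) = (i, (n + 1) div 2 + 1)"
      unfolding cell_even using n by (auto simp: crossing_def)
    moreover have "2 * n \<in> edge_set (n - 1)" unfolding even_in_edge_set by auto
    ultimately show ?thesis by blast
  next
    case 3
    then have "cell U (2 * (n + 1)) = (i, (n + 1) div 2 + 1)"
      unfolding cell_even using n by (auto simp: crossing_def elim!: oddE)
    moreover have "2 * (n + 1) \<in> edge_set (n - 1)" unfolding even_in_edge_set using n by auto
    ultimately show ?thesis by blast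
  qed
qed

lemma cell_bounds:
  assumes U: "attachment m U" and x: "x \<in> edge_set m"
  shows "fst (cell U x) \<le> ladder_rows m" "snd (cell U x) \<le> ladder_cols m"
proof -
  from x have "fst (cell U x) \<le> ladder_rows m \<and> snd (cell U x) \<le> ladder_cols m"
  proof (cases rule: edge_set_cases)
    case (1 i)
    then show ?thesis unfolding 1(1) cell_even
      by (auto simp: crossing_def ladder_rows_def ladder_cols_def elim!: evenE oddE)
  next
    case (2 i)
    with attachment_less[OF U, of i] attachment_parity[OF U, of i]
    have *: "U i < i" "even (U i) \<longleftrightarrow> odd i" "i \<le> m + 1" by auto
    then show ?thesis unfolding 2(1) cell_odd
      by (auto simp: crossing_def ladder_rows_def ladder_cols_def elim!: evenE oddE)
  qed
  then show "fst (cell U x) \<le> ladder_rows m" "snd (cell U x) \<le> ladder_cols m" by auto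
qed

definition lists_cells :: "(nat \<times> nat \<rightharpoonup> nat) \<Rightarrow> nat set \<Rightarrow> (nat \<Rightarrow> nat \<times> nat) \<Rightarrow> bool" where
  "lists_cells L A f \<longleftrightarrow> (\<forall>p x. L p = Some x \<longleftrightarrow> x \<in> A \<and> f x = p)"

lemma lists_cells_empty: "lists_cells Map.empty {} f"
  by (simp add: lists_cells_def)

lemma lists_cells_insert:
  assumes "lists_cells L A f" "f y = p" "p \<notin> f ` A"
  shows "lists_cells (L(p \<mapsto> y)) (insert y A) f"
  using assms unfolding lists_cells_def by (auto simp: image_iff)

text \<open>
  By induction along the recursion. The new row or column is vertex \<open>n + 3\<close>; its neighbours are
  vertex \<open>n + 2\<close> and the first or second neighbour of vertex \<open>n + 1\<close>, which are vertices \<open>U (n - 1)\<close>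
  and \<open>n\<close>. So the bit chooses \<open>U (n + 1)\<close> among these two.
\<close>

lemma ladder_cell:
  "\<exists>U. attachment n U \<and> (\<forall>p x. ladder n t p = Some x \<longleftrightarrow> x \<in> edge_set n \<and> cell U x = p)"
proof (induction n arbitrary: t)
  case 0
  have "cell (\<lambda>i. i - 1) 0 = (1,1)" "cell (\<lambda>i. i - 1) 2 = (1,2)"
    "cell (\<lambda>i. i - 1) 3 = (2,1)" "cell (\<lambda>i. i - 1) 4 = (2,2)"
    by (simp_all add: cell_def crossing_def)
  moreover have "edge_set 0 = {4, 3, 2, 0}" by (auto simp: edge_set_def)
  ultimately show ?case
    unfolding lists_cells_def[symmetric] ladder.simps
    by (intro exI[of _ "\<lambda>i. i - 1"])
      (auto simp: attachment_def simp del: fun_upd_apply intro!: lists_cells_insert lists_cells_empty)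
next
  case (Suc m)
  show ?case
  proof (cases m)
    case 0
    have "cell (\<lambda>i. i - 1) 0 = (1,1)" "cell (\<lambda>i. i - 1) 2 = (1,2)"
      "cell (\<lambda>i. i - 1) 3 = (2,1)" "cell (\<lambda>i. i - 1) 4 = (2,2)"
      "cell (\<lambda>i. i - 1) 5 = (1,3)" "cell (\<lambda>i. i - 1) 6 = (2,3)"
      by (simp_all add: cell_def crossing_def)
    moreover have "edge_set (Suc 0) = {6, 4, 3, 5, 2, 0}" by (auto simp: edge_set_def)
    ultimately show ?thesis unfolding 0
      unfolding lists_cells_def[symmetric] ladder.simps
      by (intro exI[of _ "\<lambda>i. i - 1"])
        (auto simp: attachment_def simp del: fun_upd_apply intro!: lists_cells_insert lists_cells_empty)
  next
    case (Suc m')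
    define n where "n = Suc m"
    have n: "n = m' + 2" "2 \<le> n" "n - 1 = m" using Suc by (auto simp: n_def)
    obtain U where U: "attachment m U"
      and L: "\<And>p x. ladder m (butlast t) p = Some x \<longleftrightarrow> x \<in> edge_set m \<and> cell U x = p"
      using Suc.IH[of "butlast t"] by blast
    have dom: "p \<in> dom (ladder m (butlast t)) \<longleftrightarrow> (\<exists>x\<in>edge_set m. cell U x = p)" for p
      by (auto simp: dom_def L)
    define U' where "U' = U(n + 1 := if last t = 0 then U (n - 1) else n)"
    have U': "attachment n U'"
      unfolding attachment_def
    proof
      fix i assume "i \<in> {1..n + 1}"
      then consider "i = n + 1" | "1 \<le> i" "i \<le> m + 1" using n by fastforce
      then show "U' i = i - 1 \<or> 3 \<le> i \<and> U' i = U' (i - 2)"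
      proof cases
        case 1
        then show ?thesis using n by (simp add: U'_def)
      next
        case 2
        then have "i \<noteq> n + 1" "i - 2 \<noteq> n + 1" using n by auto
        with attachmentD[OF U 2] show ?thesis by (simp add: U'_def)
      qed
    qed
    have old: "cell U' x = cell U x" if "x \<in> edge_set m" for x
      using that n by (cases rule: edge_set_cases) (simp_all only: cell_even cell_odd, auto simp: U'_def)
    define p q where "p = cell U' (2 * n + 3)" and "q = cell U' (2 * n + 4)"
    have less: "U (n - 1) < n - 1" "even (U (n - 1)) \<longleftrightarrow> even n"
      using attachment_less[OF U, of "n - 1"] attachment_parity[OF U, of "n - 1"] n by auto
    have p: "p = crossing (U' (n + 1)) (n + 3)" "q = crossing (n + 2) (n + 3)"
    proof -
      have *: "2 * n + 3 = 2 * (n + 1) + 1" "2 * n + 4 = 2 * (n + 2)" by simp_all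
      show "p = crossing (U' (n + 1)) (n + 3)" "q = crossing (n + 2) (n + 3)"
        unfolding p_def q_def * cell_odd cell_even by (simp_all add: eval_nat_numeral)
    qed
    have "ladder n t = (ladder m (butlast t))(p \<mapsto> 2 * n + 3, q \<mapsto> 2 * n + 4)"
    proof (cases "even n")
      case True
      have r: "ladder_rows n - 1 = n div 2 + 1" "ladder_rows n = n div 2 + 2"
        "ladder_cols n = n div 2 + 2"
        using True by (auto simp: ladder_rows_def ladder_cols_def)
      have row: "filter (\<lambda>j. (ladder_rows n - 1, j) \<in> dom (ladder m (butlast t)))
            [1..<ladder_cols n + 1] = [U (n - 1) div 2 + 1, n div 2 + 1, n div 2 + 2]"
        by (rule filter_upt_eq_three)
          (use last_row[OF _ True n(2), of U] U n(3) less True r in \<open>auto simp: dom elim!: evenE\<close>)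
      have "p = (ladder_rows n, [U (n - 1) div 2 + 1, n div 2 + 1, n div 2 + 2] ! 
               (if last t = 0 then 0 else 1))" "q = (ladder_rows n, ladder_cols n)"
        unfolding p r using True less by (auto simp: U'_def crossing_def)
      moreover have "ladder n t = (let L = ladder m (butlast t); r = ladder_rows n; c = ladder_cols n;
          k = (if last t = 0 then 0 else 1); j = filter (\<lambda>j. (r - 1, j) \<in> dom L) [1..<c + 1] ! k
             in L((r, j) \<mapsto> 2 * n + 3, (r, c) \<mapsto> 2 * n + 4))"
        unfolding n(1) using True Suc n by (simp add: Let_def)
      ultimately show ?thesis by (simp only: Let_def row)
    next
      case False
      have r: "ladder_cols n - 1 = (n + 1) div 2 + 1" "ladder_rows n = n div 2 + 2"
        "ladder_cols n = n div 2 + 3"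
        using False by (auto simp: ladder_rows_def ladder_cols_def elim!: oddE)
      have col: "filter (\<lambda>i. (i, ladder_cols n - 1) \<in> dom (ladder m (butlast t)))
            [1..<ladder_rows n + 1] = [U (n - 1) div 2 + 1, n div 2 + 1, n div 2 + 2]"
        by (rule filter_upt_eq_three)
          (use last_col[OF _ False n(2), of U] U n(3) less False r in \<open>auto simp: dom elim!: oddE\<close>)
      have "p = ([U (n - 1) div 2 + 1, n div 2 + 1, n div 2 + 2] ! 
               (if last t = 0 then 0 else 1), ladder_cols n)" "q = (ladder_rows n, ladder_cols n)"
        unfolding p r using False less by (auto simp: U'_def crossing_def elim!: oddE)
      moreover have "ladder n t = (let L = ladder m (butlast t); r = ladder_rows n; c = ladder_cols n;
          k = (if last t = 0 then 0 else 1); i = filter (\<lambda>i. (i, c - 1) \<in> dom L) [1..<r + 1] ! k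
             in L((i, c) \<mapsto> 2 * n + 3, (r, c) \<mapsto> 2 * n + 4))"
        unfolding n(1) using False Suc n by (simp add: Let_def)
      ultimately show ?thesis by (simp only: Let_def col)
    qed
    moreover have "p \<noteq> q" using less unfolding p U'_def crossing_def
      by (auto elim!: evenE oddE split: if_splits)
    moreover have "cell U x \<noteq> p" "cell U x \<noteq> q" if "x \<in> edge_set m" for x
    proof -
      have "ladder_rows m < fst p \<and> ladder_rows m < fst q \<or>
          ladder_cols m < snd p \<and> ladder_cols m < snd q"
        using less unfolding p U'_def crossing_def ladder_rows_def ladder_cols_def n_def
        by (cases "even n") (auto simp: n_def elim!: evenE oddE)
      with cell_bounds[OF U that] show "cell U x \<noteq> p" "cell U x \<noteq> q" by auto
    qed
    ultimately have "ladder n t y = Some x \<longleftrightarrow> x \<in> edge_set n \<and> cell U' x = y" for x y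
      using L[of y x] old unfolding n_def edge_set_Suc 
      by (auto simp flip: n_def p_def q_def)
    with U' show ?thesis unfolding n_def by blast
  qed
qed

section \<open>Degrees of standard monomials\<close>

text \<open>
  Monomials are handled as multisets of edges; the degree of a monomial at vertex \<open>k\<close> is the exponent
  of \<open>k\<close> in its image under the toric map.
\<close>

definition edge_incidence :: "(nat \<Rightarrow> nat) \<Rightarrow> nat \<Rightarrow> nat \<Rightarrow> nat" where
  "edge_incidence U x k =
    (if even x then of_bool (x div 2 = k) + of_bool (x div 2 + 1 = k)
     else of_bool (U (x div 2) = k) + of_bool (x div 2 + 2 = k))"

definition vertex_degree :: "(nat \<Rightarrow> nat) \<Rightarrow> nat multiset \<Rightarrow> nat \<Rightarrow> nat" where
  "vertex_degree U M k = (\<Sum>x\<in>#M. edge_incidence U x k)"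

definition standard :: "nat multiset \<Rightarrow> bool" where
  "standard M \<longleftrightarrow>
    (\<forall>i. 2 * i + 1 \<in># M \<longrightarrow> 2 * i \<notin># M \<and> 2 * i + 3 \<notin># M)"

lemma standard_subset: "standard M \<Longrightarrow> N \<subseteq># M \<Longrightarrow> standard N"
  by (meson standard_def mset_subset_eqD)

lemma vertex_degree_union: "vertex_degree U (M + N) k = vertex_degree U M k + vertex_degree U N k"
  by (simp add: vertex_degree_def)

lemma vertex_degree_replicate:
  "vertex_degree U (replicate_mset a x) k = a * edge_incidence U x k"
  by (simp add: vertex_degree_def)

lemma vertex_degree_0: 
  "(\<And>x. x \<in># M \<Longrightarrow> edge_incidence U x k = 0) \<Longrightarrow> vertex_degree U M k = 0"
  by (induction M) (auto simp: vertex_degree_def)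

text \<open>
  The last vertex \<open>N + 3\<close> has only the edges \<open>x_{2N+3}\<close> and \<open>x_{2N+4}\<close>, and \<open>x_{2N+4}\<close> also meets vertex
  \<open>N + 2\<close>. If \<open>x_{2N+3}\<close> occurs in a standard monomial then the other two edges at vertex \<open>N + 2\<close> do not,
  and its degree is the exponent of \<open>x_{2N+4}\<close>. In every case that exponent is the smaller of the
  degrees of the last two vertices.
\<close>

lemma peel_last_vertex:
  assumes U: "\<And>i. 1 \<le> i \<Longrightarrow> i \<le> Suc N \<Longrightarrow> U i < i"
    and M: "set_mset M \<subseteq> insert 0 {2..2 * Suc N + 2}" "standard M"
  obtains K a b where "M = K + replicate_mset a (2 * N + 3) + replicate_mset b (2 * N + 4)"
    "K \<subseteq># M" "set_mset K \<subseteq> insert 0 {2..2 * N + 2}"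
    "b = min (vertex_degree U M (N + 2)) (vertex_degree U M (N + 3))"
    "a = vertex_degree U M (N + 3) - b"
proof -
  define K where "K = filter_mset (\<lambda>x. x \<le> 2 * N + 2) M"
  define a where "a = count M (2 * N + 3)"
  define b where "b = count M (2 * N + 4)"
  have split: "M = K + replicate_mset a (2 * N + 3) + replicate_mset b (2 * N + 4)"
  proof (rule multiset_eqI)
    fix x
    have "x \<le> 2 * N + 2 \<or> x = 2 * N + 3 \<or> x = 2 * N + 4 \<or> x \<notin># M"
      using M(1) by force
    then show "count M x = count (K + replicate_mset a (2 * N + 3) + replicate_mset b (2 * N + 4)) x"
      by (auto simp: K_def a_def b_def not_in_iff)
  qed
  have sub: "K \<subseteq># M" by (simp add: K_def)
  have K: "set_mset K \<subseteq> insert 0 {2..2 * N + 2}" using M(1) by (auto simp: K_def)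
  have inc: "edge_incidence U (2 * N + 3) (N + 3) = 1" "edge_incidence U (2 * N + 4) (N + 3) = 1"
    "edge_incidence U (2 * N + 3) (N + 2) = 0" "edge_incidence U (2 * N + 4) (N + 2) = 1"
    using U[of "N + 1"] by (auto simp: edge_incidence_def)
  have old: "edge_incidence U x k = 0"
    if "x \<in># K" "N + 2 \<le> k" "k = N + 2 \<Longrightarrow> x \<le> 2 * N" for x k
  proof -
    from K that(1) have x: "x = 0 \<or> 2 \<le> x \<and> x \<le> 2 * N + 2" by auto
    show ?thesis
    proof (cases "even x")
      case True
      then obtain i where i: "x = 2 * i" by (rule evenE)
      with x that show ?thesis by (cases "k = N + 2") (auto simp: edge_incidence_def)
    next
      case False
      then obtain i where i: "x = 2 * i + 1" by (rule oddE)
      with x have "1 \<le> i" "i \<le> N" by auto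
      with U[of i] that i show ?thesis
        by (cases "k = N + 2") (auto simp: edge_incidence_def)
    qed
  qed
  have "vertex_degree U K (N + 3) = 0" by (rule vertex_degree_0, rule old) auto
  then have deg3: "vertex_degree U M (N + 3) = a + b"
    by (subst split) (simp add: vertex_degree_union vertex_degree_replicate inc)
  have deg2: "vertex_degree U M (N + 2) = vertex_degree U K (N + 2) + b"
    by (subst split) (simp only: vertex_degree_union vertex_degree_replicate inc mult_0_right mult_1_right add_0_right)
  have "vertex_degree U K (N + 2) = 0" if "a > 0"
  proof (rule vertex_degree_0, rule old)
    fix x assume x: "x \<in># K"
    from that have "2 * N + 3 \<in># M" by (simp add: a_def)
    then have "2 * N + 2 \<notin># M" "2 * N + 1 \<notin># M"
      using M(2)[unfolded standard_def, rule_format, of "N + 1"]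
        M(2)[unfolded standard_def, rule_format, of N] by (auto simp: eval_nat_numeral)
    with x sub have "x \<noteq> 2 * N + 2" "x \<noteq> 2 * N + 1" by (auto dest: mset_subset_eqD)
    with x K show "x \<le> 2 * N" by force
  qed simp_all
  then have "b = min (vertex_degree U M (N + 2)) (vertex_degree U M (N + 3))"
    unfolding deg2 deg3 by (cases "a = 0") auto
  moreover from deg3 have "a = vertex_degree U M (N + 3) - b" by simp
  ultimately show ?thesis using that split sub K by blast
qed

lemma standard_eqI:
  assumes "\<And>i. 1 \<le> i \<Longrightarrow> i \<le> N \<Longrightarrow> U i < i"
    and "set_mset M \<subseteq> insert 0 {2..2 * N + 2}" "standard M"
    and "set_mset M' \<subseteq> insert 0 {2..2 * N + 2}" "standard M'"
    and "\<And>k. vertex_degree U M k = vertex_degree U M' k"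
  shows "M = M'"
  using assms
proof (induction N arbitrary: M M')
  case 0
  have "K = replicate_mset (vertex_degree U K 0) 0 + replicate_mset (vertex_degree U K 2) 2"
    if "set_mset K \<subseteq> {0, 2}" for K
    using that
    by (induction K) (auto simp: vertex_degree_def edge_incidence_def)
  moreover have "set_mset M \<subseteq> {0, 2}" "set_mset M' \<subseteq> {0, 2}" using 0 by auto
  ultimately show ?case using 0(6) by metis
next
  case (Suc N)
  obtain K a b where M: "M = K + replicate_mset a (2 * N + 3) + replicate_mset b (2 * N + 4)"
    "K \<subseteq># M" "set_mset K \<subseteq> insert 0 {2..2 * N + 2}"
    "b = min (vertex_degree U M (N + 2)) (vertex_degree U M (N + 3))"
    "a = vertex_degree U M (N + 3) - b"
    using peel_last_vertex[OF Suc.prems(1-3)] by blast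
  obtain K' a' b' where M': "M' = K' + replicate_mset a' (2 * N + 3) + replicate_mset b' (2 * N + 4)"
    "K' \<subseteq># M'" "set_mset K' \<subseteq> insert 0 {2..2 * N + 2}"
    "b' = min (vertex_degree U M' (N + 2)) (vertex_degree U M' (N + 3))"
    "a' = vertex_degree U M' (N + 3) - b'"
    using peel_last_vertex[OF Suc.prems(1,4,5)] by blast
  have ab: "a = a'" "b = b'" unfolding M(4,5) M'(4,5) Suc.prems(6) by (rule refl)+
  have "K = K'"
  proof (rule Suc.IH)
    fix k
    from Suc.prems(6)[of k] show "vertex_degree U K k = vertex_degree U K' k"
      unfolding M(1) M'(1) ab by (simp add: vertex_degree_union)
  qed (use Suc.prems(1) M(3) M'(3) standard_subset[OF Suc.prems(3) M(2)]
      standard_subset[OF Suc.prems(5) M'(2)] in \<open>simp_all only: le_SucI\<close>)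
  with M(1) M'(1) ab show ?case by simp
qed

definition sparse :: "nat \<Rightarrow> nat set \<Rightarrow> bool" where
  "sparse N F \<longleftrightarrow> F \<subseteq> {1..N} \<and> (\<forall>i\<in>F. Suc i \<notin> F)"

lemma sparse_finite: "sparse N F \<Longrightarrow> finite F"
  by (auto simp: sparse_def intro: finite_subset)

text \<open>
  The standard monomial of the pair of a parameter monomial \<open>A\<close> and a sparse set \<open>F\<close>: each factor \<open>i\<close>
  of \<open>A\<close> becomes \<open>x_{2i+1}\<close> or \<open>x_{2i}\<close> according to whether \<open>x_{2i+1}\<close> already occurs because of \<open>F\<close>.
\<close>

definition standard_of :: "nat multiset \<times> nat set \<Rightarrow> nat multiset" where
  "standard_of = (\<lambda>(A, F). image_mset (\<lambda>i. if i \<in> F then 2 * i + 1 else 2 * i) A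
     + image_mset (\<lambda>i. 2 * i + 1) (mset_set F))"

lemma size_standard_of: "size (standard_of (A, F)) = size A + card F"
  by (simp add: standard_of_def)

lemma in_standard_of:
  assumes "finite F"
  shows "2 * i + 1 \<in># standard_of (A, F) \<longleftrightarrow> i \<in> F"
    "2 * i \<in># standard_of (A, F) \<longleftrightarrow> i \<in># A \<and> i \<notin> F"
proof -
  show "2 * i + 1 \<in># standard_of (A, F) \<longleftrightarrow> i \<in> F"
    using assms by (auto simp: standard_of_def split: if_splits) presburger+
  show "2 * i \<in># standard_of (A, F) \<longleftrightarrow> i \<in># A \<and> i \<notin> F"
    using assms by (auto simp: standard_of_def image_iff split: if_splits) presburger+
qed

lemma standard_standard_of:
  assumes "sparse N F"
  shows "standard (standard_of (A, F))"
proof -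
  have F: "finite F" using assms by (rule sparse_finite)
  have "2 * i + 3 \<in># standard_of (A, F) \<longleftrightarrow> Suc i \<in> F" for i
  proof -
    have "2 * i + 3 = 2 * Suc i + 1" by simp
    then show ?thesis by (simp only: in_standard_of(1)[OF F])
  qed
  with assms in_standard_of[OF F] show ?thesis by (auto simp: standard_def sparse_def)
qed

lemma inj_standard_of: "inj_on standard_of {(A, F). finite F}"
proof (rule inj_onI, clarify)
  fix A F A' F' assume F: "finite F" "finite F'" and eq: "standard_of (A, F) = standard_of (A', F')"
  have FF: "F = F'"
    using in_standard_of(1)[OF F(1), of _ A] in_standard_of(1)[OF F(2), of _ A'] eq by auto
  have "inj (\<lambda>i. if i \<in> F then 2 * i + 1 else 2 * i)"
    by (rule injI) (auto split: if_splits)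
  moreover have "image_mset (\<lambda>i. if i \<in> F then 2 * i + 1 else 2 * i) A =
      image_mset (\<lambda>i. if i \<in> F then 2 * i + 1 else 2 * i) A'"
    using eq FF by (simp add: standard_of_def)
  ultimately have "A = A'" by (rule injD[OF multiset.inj_map])
  with FF show "A = A' \<and> F = F'" by simp
qed

text \<open>
  A sparse subset of \<open>{1..N}\<close> either omits \<open>N\<close>, or consists of \<open>N\<close> and a sparse subset of
  \<open>{1..N-2}\<close>; this is Pascal's rule.
\<close>

lemma card_sparse_subsets:
  "card {F. sparse N F \<and> card F = i} = (N + 1 - i) choose i"
proof (induction N arbitrary: i rule: less_induct)
  case (less N)
  have fin: "finite {F. sparse M F \<and> card F = i}" for M i
    by (rule finite_subset[of _ "Pow {1..M}"]) (auto simp: sparse_def)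
  consider "i = 0" | "N = 0" "i > 0" | "N = 1" "i > 0" | M j where "N = Suc (Suc M)" "i = Suc j"
    by (metis One_nat_def gr0_conv_Suc not_gr_zero)
  then show ?case
  proof cases
    case 1
    have "{F. sparse N F \<and> card F = 0} = {{}}" using sparse_finite by (auto simp: sparse_def)
    with 1 show ?thesis by simp
  next
    case 2
    then have *: "{F. sparse N F \<and> card F = i} = {}" by (auto simp: sparse_def)
    show ?thesis unfolding * using 2 by simp
  next
    case 3
    have "sparse 1 F \<longleftrightarrow> F = {} \<or> F = {1}" for F by (auto simp: sparse_def)
    then have *: "{F. sparse N F \<and> card F = i} = {F. (F = {} \<or> F = {1}) \<and> card F = i}"
      unfolding 3(1) by simp
    also have "\<dots> = (if i = 1 then {{1}} else {})" using 3(2) by auto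
    finally have *: "card {F. sparse N F \<and> card F = i} = (if i = 1 then 1 else 0)" by simp
    show ?thesis unfolding * using 3 by (cases "i = 1") (simp_all add: binomial_eq_0)
  next
    case 4
    let ?A = "{F. sparse (Suc M) F \<and> card F = Suc j}" and ?B = "{F. sparse M F \<and> card F = j}"
    have not_in: "Suc (Suc M) \<notin> F" if "sparse M F" for F using that by (auto simp: sparse_def)
    have "{F. sparse N F \<and> card F = i} = ?A \<union> insert N ` ?B"
    proof (intro equalityI subsetI)
      fix F assume "F \<in> {F. sparse N F \<and> card F = i}"
      then have F: "sparse N F" "card F = i" by auto
      show "F \<in> ?A \<union> insert N ` ?B"
      proof (cases "N \<in> F")
        case True
        have "Suc M \<notin> F" using True F(1) 4 by (auto simp: sparse_def)
        then have "sparse M (F - {N})" using F(1) 4 by (fastforce simp: sparse_def le_Suc_eq)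
        moreover have "card (F - {N}) = j" using True F 4 sparse_finite[OF F(1)] by simp
        ultimately show ?thesis using True by (intro UnI2 image_eqI[of _ _ "F - {N}"]) auto
      next
        case False
        then have "sparse (Suc M) F" using F(1) 4 by (fastforce simp: sparse_def le_Suc_eq)
        then show ?thesis using F 4 by auto
      qed
    next
      fix F assume "F \<in> ?A \<union> insert N ` ?B"
      then show "F \<in> {F. sparse N F \<and> card F = i}"
      proof
        assume "F \<in> insert N ` ?B"
        then obtain F' where F': "F = insert N F'" "sparse M F'" "card F' = j" by auto
        then have "sparse N F" using 4 by (auto simp: sparse_def)
        moreover have "card F = i" using F' 4 sparse_finite not_in by simp
        ultimately show ?thesis by simp
      qed (use 4 in \<open>auto simp: sparse_def\<close>)
    qed
    moreover have "?A \<inter> insert N ` ?B = {}" using 4 by (auto simp: sparse_def)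
    moreover have "inj_on (insert N) ?B" using 4 not_in by (intro inj_onI) (metis (no_types, lifting) insert_ident mem_Collect_eq)
    ultimately have "card {F. sparse N F \<and> card F = i} = card ?A + card ?B"
      by (simp add: card_Un_disjoint fin card_image)
    also have "\<dots> = (Suc M + 1 - Suc j choose Suc j) + (M + 1 - j choose j)"
      using less.IH[of "Suc M" "Suc j"] less.IH[of M j] 4 by simp
    also have "\<dots> = (N + 1 - i choose i)"
      using 4 by (cases "j \<le> M + 1") (auto simp: Suc_diff_le binomial_eq_0)
    finally show ?thesis .
  qed
qed

section \<open>Polynomial rings, substitution and toric ideals\<close>

lemma const_mult: "const (a * b) = const a * const b"
  by (simp add: const_def mult_single)

lemma const_add: "const (a + b) = const a + const b"
  by (simp add: const_def single_add)

lemma const_1 [simp]: "const 1 = 1" and const_0 [simp]: "const 0 = 0"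
  by (simp_all add: const_def)

lemma const_mult_single: "const c * Poly_Mapping.single m d = Poly_Mapping.single m (c * d)"
  by (simp add: const_def mult_single)

global_interpretation mp: vector_space "\<lambda>c p. const c * (p :: ('v, 'k::field) mpol)"
  by unfold_locales (simp_all add: const_mult const_add algebra_simps)

lemma mpol_expand:
  fixes p :: "('v, 'k::field) mpol"
  shows "p = (\<Sum>m\<in>Poly_Mapping.keys p. const (Poly_Mapping.lookup p m) * Poly_Mapping.single m 1)"
proof (rule poly_mapping_eqI)
  fix k
  have "Poly_Mapping.lookup
      (\<Sum>m\<in>Poly_Mapping.keys p. const (Poly_Mapping.lookup p m) * Poly_Mapping.single m 1) k =
      (\<Sum>m\<in>Poly_Mapping.keys p. if m = k then Poly_Mapping.lookup p m else 0)"
    by (simp add: lookup_sum const_mult_single lookup_single when_def)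
  also have "\<dots> = Poly_Mapping.lookup p k"
    by (simp add: in_keys_iff)
  finally show "Poly_Mapping.lookup p k = Poly_Mapping.lookup
      (\<Sum>m\<in>Poly_Mapping.keys p. const (Poly_Mapping.lookup p m) * Poly_Mapping.single m 1) k" ..
qed

lemma mpol_induct [case_names zero single add]:
  fixes p :: "('v, 'k::field) mpol"
  assumes "P 0" "\<And>c m. P (Poly_Mapping.single m c)" "\<And>p q. P p \<Longrightarrow> P q \<Longrightarrow> P (p + q)"
  shows "P p"
proof -
  have "P (\<Sum>m\<in>A. const (Poly_Mapping.lookup p m) * Poly_Mapping.single m 1)" if "finite A" for A
    using that by (induction A) (simp_all add: assms const_mult_single)
  from this[of "Poly_Mapping.keys p"] show ?thesis by (simp flip: mpol_expand)
qed

definition subst_monomial :: "('v \<Rightarrow> ('w, 'k::field) mpol) \<Rightarrow> ('v \<Rightarrow>\<^sub>0 nat) \<Rightarrow> ('w, 'k) mpol" where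
  "subst_monomial f m = (\<Prod>v \<in> Poly_Mapping.keys m. f v ^ Poly_Mapping.lookup m v)"

lemma subst_monomial_superset:
  assumes "finite A" "Poly_Mapping.keys m \<subseteq> A"
  shows "subst_monomial f m = (\<Prod>v\<in>A. f v ^ Poly_Mapping.lookup m v)"
  unfolding subst_monomial_def using assms
  by (intro prod.mono_neutral_left) (auto simp: in_keys_iff)

lemma subst_monomial_add:
  "subst_monomial f (m + m') = subst_monomial f m * subst_monomial f m'"
proof -
  let ?A = "Poly_Mapping.keys m \<union> Poly_Mapping.keys m'"
  show ?thesis
    using subst_monomial_superset[of ?A m f] subst_monomial_superset[of ?A m' f]
      subst_monomial_superset[of ?A "m + m'" f] keys_add[of m m']
    by (simp add: lookup_add power_add prod.distrib)
qed

lemma poly_subst_add: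
  "poly_subst f (p + q) = poly_subst f p + poly_subst f q"
  unfolding poly_subst_def
  by (rule setsum_keys_plus_distrib) (simp_all add: const_add distrib_right)

lemma poly_subst_0 [simp]: "poly_subst f 0 = 0"
  by (simp add: poly_subst_def)

lemma poly_subst_single: "poly_subst f (Poly_Mapping.single m c) = const c * subst_monomial f m"
  by (cases "c = 0") (simp_all add: poly_subst_def subst_monomial_def)

lemma poly_subst_mult:
  "poly_subst f (p * q) = poly_subst f p * poly_subst f q"
proof (induction p rule: mpol_induct)
  case (single c m)
  show ?case
  proof (induction q rule: mpol_induct)
    case (single d m')
    show ?case
      by (simp only: mult_single poly_subst_single subst_monomial_add const_mult mult_ac)
  qed (simp_all only: mult_zero_right poly_subst_0 distrib_left poly_subst_add)
qed (simp_all only: mult_zero_left poly_subst_0 distrib_right poly_subst_add)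

lemma poly_subst_const [simp]: "poly_subst f (const c) = const c"
proof -
  have "poly_subst f (const c) = const c * subst_monomial f 0"
    unfolding const_def[of c] poly_subst_single ..
  then show ?thesis by (simp add: subst_monomial_def)
qed

lemma poly_subst_1 [simp]: "poly_subst f 1 = 1"
  using poly_subst_const[of f 1] by simp

lemma poly_subst_var [simp]: "poly_subst f (var v) = f v"
  by (simp add: var_def poly_subst_single subst_monomial_def)

lemma poly_subst_uminus: "poly_subst f (- p) = - poly_subst f p"
  using poly_subst_add[of f p "- p"] by (simp add: minus_unique)

lemma poly_subst_diff: "poly_subst f (p - q) = poly_subst f p - poly_subst f q"
  using poly_subst_add[of f p "- q"] by (simp add: poly_subst_uminus)

lemma poly_subst_prod: "poly_subst f (\<Prod>i\<in>A. g i) = (\<Prod>i\<in>A. poly_subst f (g i))"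
  by (induction A rule: infinite_finite_induct) (simp_all add: poly_subst_mult)

lemma poly_subst_sum: "poly_subst f (\<Sum>i\<in>A. g i) = (\<Sum>i\<in>A. poly_subst f (g i))"
  by (induction A rule: infinite_finite_induct) (simp_all add: poly_subst_add)

lemma poly_ring_carrier: 
  "carrier (poly_ring X) = {p. \<forall>m \<in> Poly_Mapping.keys p. Poly_Mapping.keys m \<subseteq> X}"
  by (simp add: poly_ring_def)

lemma poly_ring_carrierI:
  "(\<And>m. m \<in> Poly_Mapping.keys p \<Longrightarrow> Poly_Mapping.keys m \<subseteq> X) \<Longrightarrow> p \<in> carrier (poly_ring X)"
  by (auto simp: poly_ring_carrier)

lemma poly_ring_closed:
  fixes p q :: "('v, 'k::field) mpol"
  shows "0 \<in> carrier (poly_ring X)" "1 \<in> carrier (poly_ring X)" 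
    "p \<in> carrier (poly_ring X) \<Longrightarrow> q \<in> carrier (poly_ring X) \<Longrightarrow> p + q \<in> carrier (poly_ring X)"
    "p \<in> carrier (poly_ring X) \<Longrightarrow> q \<in> carrier (poly_ring X) \<Longrightarrow> p * q \<in> carrier (poly_ring X)"
    "p \<in> carrier (poly_ring X) \<Longrightarrow> - p \<in> carrier (poly_ring X)"
    "p \<in> carrier (poly_ring X) \<Longrightarrow> q \<in> carrier (poly_ring X) \<Longrightarrow> p - q \<in> carrier (poly_ring X)"
proof -
  show add: "p + q \<in> carrier (poly_ring X)"
    if "p \<in> carrier (poly_ring X)" "q \<in> carrier (poly_ring X)" for p q :: "('v, 'k) mpol"
    using that keys_add[of p q] by (auto simp: poly_ring_carrier)
  show "p * q \<in> carrier (poly_ring X)"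
    if pq: "p \<in> carrier (poly_ring X)" "q \<in> carrier (poly_ring X)"
  proof (rule poly_ring_carrierI)
    fix m assume "m \<in> Poly_Mapping.keys (p * q)"
    then obtain a b where m: "m = a + b" "a \<in> Poly_Mapping.keys p" "b \<in> Poly_Mapping.keys q"
      using keys_mult[of p q] by blast
    then have "Poly_Mapping.keys a \<subseteq> X" "Poly_Mapping.keys b \<subseteq> X"
      using pq by (simp_all add: poly_ring_carrier)
    then show "Poly_Mapping.keys m \<subseteq> X" unfolding m(1) using keys_add[of a b] by blast
  qed
  show neg: "- p \<in> carrier (poly_ring X)" if "p \<in> carrier (poly_ring X)" for p :: "('v, 'k) mpol"
    using that by (simp add: poly_ring_carrier in_keys_iff)
  show "p - q \<in> carrier (poly_ring X)"
    if "p \<in> carrier (poly_ring X)" "q \<in> carrier (poly_ring X)"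
    using add[OF that(1) neg[OF that(2)]] by simp
qed (simp_all add: poly_ring_carrier)

lemma const_in_poly_ring: "const c \<in> carrier (poly_ring X)"
  by (auto simp: poly_ring_carrier const_def split: if_splits)

lemma var_in_poly_ring: "v \<in> X \<Longrightarrow> var v \<in> carrier (poly_ring X)"
  by (auto simp: poly_ring_carrier var_def)

lemma poly_ring_simps [simp]:
  "monoid.mult (poly_ring X) p q = p * q" "add (poly_ring X) p q = p + q"
  "one (poly_ring X) = 1" "zero (poly_ring X) = 0"
  by (simp_all add: poly_ring_def)

lemma poly_ring_cring: "cring (poly_ring X :: ('v, 'k::field) mpol ring)"
proof (rule cringI)
  show "abelian_group (poly_ring X :: ('v, 'k) mpol ring)"
  proof (rule abelian_groupI)
    fix x :: "('v, 'k) mpol" assume "x \<in> carrier (poly_ring X)"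
    then show "\<exists>y\<in>carrier (poly_ring X). y \<oplus>\<^bsub>poly_ring X\<^esub> x = \<zero>\<^bsub>poly_ring X\<^esub>"
      by (intro bexI[of _ "- x"] poly_ring_closed) simp_all
  qed (use poly_ring_closed in \<open>auto simp: algebra_simps\<close>)
  show "Group.comm_monoid (poly_ring X :: ('v, 'k) mpol ring)"
    by (rule comm_monoidI) (use poly_ring_closed in \<open>auto simp: algebra_simps\<close>)
qed (auto simp: algebra_simps)

lemma poly_subst_closed:
  assumes "p \<in> carrier (poly_ring X)" "\<And>v. v \<in> X \<Longrightarrow> f v \<in> carrier (poly_ring Y)"
  shows "poly_subst f p \<in> carrier (poly_ring Y)"
proof -
  have pow: "q ^ i \<in> carrier (poly_ring Y)" if "q \<in> carrier (poly_ring Y)" for q i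
    using that by (induction i) (auto intro: poly_ring_closed)
  have prod: "(\<Prod>v\<in>A. g v) \<in> carrier (poly_ring Y)"
    if "\<And>v. v \<in> A \<Longrightarrow> g v \<in> carrier (poly_ring Y)" for A and g :: "'a \<Rightarrow> _"
    using that by (induction A rule: infinite_finite_induct) (auto intro: poly_ring_closed)
  have sum: "(\<Sum>v\<in>A. g v) \<in> carrier (poly_ring Y)"
    if "\<And>v. v \<in> A \<Longrightarrow> g v \<in> carrier (poly_ring Y)" for A and g :: "('a \<Rightarrow>\<^sub>0 nat) \<Rightarrow> _"
    using that by (induction A rule: infinite_finite_induct) (auto intro: poly_ring_closed)
  show ?thesis unfolding poly_subst_def
    using assms(1) by (intro sum poly_ring_closed(4) const_in_poly_ring prod pow assms(2))
      (auto simp: poly_ring_carrier)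
qed

definition toric_map :: "('v, 'e) edge_graph \<Rightarrow> ('e, 'k::field) mpol \<Rightarrow> ('v, 'k) mpol" where
  "toric_map G = poly_subst (\<lambda>e. \<Prod>v \<in> ends G e. var v)"

lemma toric_ideal_eq:
  "toric_ideal G = {p \<in> carrier (poly_ring (edges G)). toric_map G p = 0}"
  by (simp add: toric_ideal_def a_kernel_def' toric_map_def)

lemma toric_ideal_is_ideal:
  fixes G :: "('v, 'e) edge_graph"
  assumes "\<And>e. e \<in> edges G \<Longrightarrow> ends G e \<subseteq> verts G"
  shows "ideal (toric_ideal G :: ('e, 'k::field) mpol set) (poly_ring (edges G))"
proof -
  let ?R = "poly_ring (edges G) :: ('e, 'k) mpol ring" and ?S = "poly_ring (verts G) :: ('v, 'k) mpol ring"
  have "(\<Prod>v\<in>A. var v) \<in> carrier ?S" if "A \<subseteq> verts G" for A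
    using that by (induction A rule: infinite_finite_induct) (auto intro: poly_ring_closed var_in_poly_ring)
  then have "ring_hom_ring ?R ?S (toric_map G)"
    unfolding toric_map_def
    by (intro ring_hom_ringI cring.axioms poly_ring_cring poly_subst_closed)
      (use assms in \<open>auto simp: poly_subst_add poly_subst_mult\<close>)
  from ring_hom_ring.kernel_is_ideal[OF this] show ?thesis
    by (simp add: toric_ideal_def toric_map_def)
qed

lemma poly_ring_a_inv:
  assumes "p \<in> carrier (poly_ring X)"
  shows "\<ominus>\<^bsub>poly_ring X\<^esub> p = - p"
proof -
  interpret cring "poly_ring X :: ('a, 'b) mpol ring" by (rule poly_ring_cring)
  show ?thesis using assms by (intro minus_equality) (auto intro: poly_ring_closed)
qed

lemma poly_ring_a_minus:
  assumes "p \<in> carrier (poly_ring X)" "q \<in> carrier (poly_ring X)"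
  shows "p \<ominus>\<^bsub>poly_ring X\<^esub> q = p - q"
  using assms by (simp add: a_minus_def poly_ring_a_inv)

lemma poly_ring_sum:
  "(\<And>x. x \<in> A \<Longrightarrow> f x \<in> carrier (poly_ring X)) \<Longrightarrow> sum f A \<in> carrier (poly_ring X)"
  by (induction A rule: infinite_finite_induct) (auto intro: poly_ring_closed)

lemma homogeneous_mult:
  assumes "homogeneous d p" "homogeneous e q"
  shows "homogeneous (d + e) (p * q)"
  unfolding homogeneous_def
proof
  fix m assume "m \<in> Poly_Mapping.keys (p * q)"
  then obtain a b where m: "m = a + b" "a \<in> Poly_Mapping.keys p" "b \<in> Poly_Mapping.keys q"
    using keys_mult[of p q] by blast
  have "(\<Sum>v\<in>Poly_Mapping.keys m. Poly_Mapping.lookup m v) =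
      (\<Sum>v\<in>Poly_Mapping.keys a. Poly_Mapping.lookup a v) +
      (\<Sum>v\<in>Poly_Mapping.keys b. Poly_Mapping.lookup b v)"
    unfolding m(1) by (rule setsum_keys_plus_distrib) auto
  with m assms show "(\<Sum>v\<in>Poly_Mapping.keys m. Poly_Mapping.lookup m v) = d + e"
    by (simp add: homogeneous_def)
qed

lemma homogeneous_const: "homogeneous 0 (const c)"
  by (auto simp: homogeneous_def const_def split: if_splits)

lemma homogeneous_var: "homogeneous 1 (var v)"
  by (simp add: homogeneous_def var_def)

lemma homogeneous_sum:
  assumes "\<And>x. x \<in> A \<Longrightarrow> homogeneous d (f x)"
  shows "homogeneous d (sum f A)"
  unfolding homogeneous_def
proof
  fix m assume "m \<in> Poly_Mapping.keys (sum f A)"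
  then obtain x where "x \<in> A" "m \<in> Poly_Mapping.keys (f x)" using keys_sum[of f A] by blast
  with assms show "(\<Sum>v\<in>Poly_Mapping.keys m. Poly_Mapping.lookup m v) = d"
    by (auto simp: homogeneous_def)
qed

section \<open>Independent families and monomials\<close>

text \<open>
  A maximal independent part of the family has at least \<open>card S\<close> elements by the exchange lemma, which
  leaves no room for it to be a proper part or for a repetition in the family.
\<close>

lemma (in vector_space) independent_family_by_counting:
  assumes "finite I" "independent S" "card I \<le> card S" "S \<subseteq> span (b ` I)"
  shows "inj_on b I" "independent (b ` I)"
proof -
  obtain C where C: "C \<subseteq> b ` I" "independent C" "b ` I \<subseteq> span C"
    using maximal_independent_subset by blast
  have fin: "finite (b ` I)" using assms(1) by simp
  have "finite C" using finite_subset[OF C(1) fin] .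
  have "S \<subseteq> span C"
    using assms(4) span_minimal[OF C(3) subspace_span] by blast
  then have "card S \<le> card C"
    using independent_span_bound[OF \<open>finite C\<close> assms(2)] by blast
  moreover have "card C \<le> card (b ` I)" using C(1) fin by (rule card_mono[rotated])
  moreover have "card (b ` I) \<le> card I" using assms(1) by (rule card_image_le)
  ultimately have "card C = card (b ` I)" "card (b ` I) = card I" using assms(3) by linarith+
  then show "inj_on b I" "independent (b ` I)"
    using eq_card_imp_inj_on[OF assms(1)] card_subset_eq[OF fin C(1)] C(2) by auto
qed

lemma monomials_independent:
  "mp.independent ((\<lambda>m. Poly_Mapping.single m (1::'k::field)) ` (E :: ('v \<Rightarrow>\<^sub>0 nat) set))"
proof
  let ?X = "\<lambda>m. Poly_Mapping.single m (1::'k) :: ('v, 'k) mpol"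
  assume "mp.dependent (?X ` E)"
  then obtain m where m: "m \<in> E" "?X m \<in> mp.span (?X ` E - {?X m})"
    unfolding mp.dependent_def by blast
  have "mp.subspace {p :: ('v, 'k) mpol. Poly_Mapping.lookup p m = 0}"
    by (rule mp.subspaceI)
      (simp_all add: lookup_add const_def mult_map_scale_conv_mult[symmetric] map.rep_eq when_def)
  then have "mp.span (?X ` E - {?X m}) \<subseteq> {p. Poly_Mapping.lookup p m = 0}"
    by (intro mp.span_minimal) (auto simp: lookup_single when_def)
  with m(2) have "Poly_Mapping.lookup (?X m) m = 0" by blast
  then show False by simp
qed

definition monomial :: "nat multiset \<Rightarrow> (nat, 'k::field) mpol" where
  "monomial M = (\<Prod>x\<in>#M. var x)"

lemma monomial_union: "monomial (M + N) = monomial M * monomial N"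
  and monomial_add_mset: "monomial (add_mset x M) = var x * monomial M"
  and monomial_empty: "monomial {#} = 1"
  by (simp_all add: monomial_def)

lemma single_eq_monomial:
  "\<exists>M. Poly_Mapping.single m 1 = (monomial M :: (nat, 'k::field) mpol) \<and>
     set_mset M = Poly_Mapping.keys m \<and>
     size M = (\<Sum>v\<in>Poly_Mapping.keys m. Poly_Mapping.lookup m v)"
proof (induction m rule: update_induct)
  case const
  show ?case by (rule exI[of _ "{#}"]) (simp add: monomial_def)
next
  case (update m x e)
  have "Poly_Mapping.single (Poly_Mapping.single x e) 1 = (monomial (replicate_mset e x) :: (nat, 'k) mpol)"
  proof (induction e)
    case (Suc e)
    have "Poly_Mapping.single x (Suc e) = Poly_Mapping.single x 1 + Poly_Mapping.single x e"
      using single_add[of x 1 e] by simp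
    with Suc show ?case by (simp add: monomial_add_mset var_def mult_single flip: Suc)
  qed (simp add: monomial_empty)
  moreover obtain M where M: "Poly_Mapping.single m 1 = (monomial M :: (nat, 'k) mpol)"
     "set_mset M = Poly_Mapping.keys m" "size M = (\<Sum>v\<in>Poly_Mapping.keys m. Poly_Mapping.lookup m v)"
    using update.IH by blast
  moreover have u: "Poly_Mapping.update x e m = m + Poly_Mapping.single x e"
    using update.hyps by (intro poly_mapping_eqI)
      (auto simp: lookup_update lookup_add lookup_single when_def in_keys_iff)
  ultimately have "Poly_Mapping.single (Poly_Mapping.update x e m) 1 =
      (monomial (M + replicate_mset e x) :: (nat, 'k) mpol)"
    using mult_single[of m "1::'k" "Poly_Mapping.single x e" 1]
    unfolding u by (simp add: monomial_union)
  moreover have k: "Poly_Mapping.keys (Poly_Mapping.update x e m) = insert x (Poly_Mapping.keys m)"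
    using update.hyps by (simp add: keys_update)
  moreover have "(\<Sum>v\<in>Poly_Mapping.keys m. Poly_Mapping.lookup (Poly_Mapping.update x e m) v) =
      (\<Sum>v\<in>Poly_Mapping.keys m. Poly_Mapping.lookup m v)"
    using update.hyps by (intro sum.cong) (auto simp: lookup_update)
  ultimately show ?case
    using M(2,3) update.hyps
    by (intro exI[of _ "M + replicate_mset e x"]) (auto simp: lookup_update)
qed

section \<open>The toric ring as a free module over the parameters\<close>

definition vertex :: "nat \<Rightarrow> nat + nat" where
  "vertex i = (if even i then Inr (i div 2 + 1) else Inl (i div 2 + 1))"

lemma vertex_eq_iff [simp]: "vertex i = vertex j \<longleftrightarrow> i = j"
  by (simp add: vertex_def) presburger

locale ladder_graph =
  fixes n :: nat and t :: "bit list" and U :: "nat \<Rightarrow> nat"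
  assumes attachment: "attachment n U"
    and ladder_iff: "ladder n t p = Some x \<longleftrightarrow> x \<in> edge_set n \<and> cell U x = p"
begin

abbreviation psi :: "(nat, 'k::field) mpol \<Rightarrow> (nat + nat, 'k) mpol" where
  "psi \<equiv> toric_map (G_graph n t)"

lemma psi_simps [simp]:
  "psi (p + q) = psi p + psi q" "psi (p * q) = psi p * psi q" "psi (p - q) = psi p - psi q"
  "psi (- p) = - psi p"
  "psi 0 = 0" "psi 1 = 1" "psi (const c) = const c" "psi (prod f A) = (\<Prod>i\<in>A. psi (f i))" 
  "psi (sum f A) = (\<Sum>i\<in>A. psi (f i))"
  by (simp_all add: toric_map_def poly_subst_add poly_subst_mult poly_subst_diff poly_subst_uminus
      poly_subst_prod poly_subst_sum)

lemma edges_eq: "edges (G_graph n t) = edge_set n"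
  by (auto simp: G_graph_def ran_def ladder_iff)

lemma ends_eq:
  assumes "x \<in> edge_set n"
  shows "ends (G_graph n t) x = {Inl (fst (cell U x)), Inr (snd (cell U x))}"
proof -
  obtain a b where "cell U x = (a, b)" by fastforce
  with assms show ?thesis by (auto simp: G_graph_def ladder_iff)
qed

lemma ends_subset: "e \<in> edges (G_graph n t) \<Longrightarrow> ends (G_graph n t) e \<subseteq> verts (G_graph n t)"
  using cell_bounds[OF attachment, of e]
  by (simp add: edges_eq ends_eq) (auto simp: G_graph_def cell_def crossing_def)

lemma psi_var:
  assumes "x \<in> edge_set n"
  shows "psi (var x) = var (Inl (fst (cell U x))) * var (Inr (snd (cell U x)))"
  using assms by (simp add: toric_map_def ends_eq)

lemma psi_even: "i \<le> n + 2 \<Longrightarrow> psi (var (2 * i)) = var (vertex i) * var (vertex (i + 1))"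
  by (simp only: psi_var cell_even even_in_edge_set) (auto simp: crossing_def vertex_def mult.commute)

lemma psi_odd:
  assumes "1 \<le> i" "i \<le> n + 1"
  shows "psi (var (2 * i + 1)) = var (vertex (U i)) * var (vertex (i + 2))"
proof -
  have "2 * i + 1 \<in> edge_set n" using assms by (simp only: odd_in_edge_set)
  moreover have "even (U i) \<longleftrightarrow> odd i" using attachment_parity[OF attachment assms] .
  ultimately show ?thesis
    by (simp only: psi_var cell_odd) (auto simp: crossing_def vertex_def mult.commute)
qed

text \<open>
  Vertex \<open>U i\<close> is adjacent to vertex \<open>i\<close>, by a path edge if it is \<open>i - 1\<close> and otherwise because
  \<open>U (i - 2)\<close> is the vertex to which \<open>i\<close> was attached.
\<close>

lemma attachment_edge:
  assumes "1 \<le> i" "i \<le> n + 1"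
  shows "\<exists>x\<in>edge_set n. psi (var x) = (var (vertex (U i)) * var (vertex i) :: (nat + nat, 'k::field) mpol)"
  using attachmentD[OF attachment assms]
proof
  assume "U i = i - 1"
  with assms psi_even[of "i - 1"] even_in_edge_set[of "i - 1" n] show ?thesis
    by (intro bexI[of _ "2 * (i - 1)"]) auto
next
  assume *: "3 \<le> i \<and> U i = U (i - 2)"
  with assms have "2 * (i - 2) + 1 \<in> edge_set n" by (simp only: odd_in_edge_set) auto
  moreover have "psi (var (2 * (i - 2) + 1)) = (var (vertex (U i)) * var (vertex i) :: (nat + nat, 'k) mpol)"
  proof -
    have "1 \<le> i - 2" "i - 2 \<le> n + 1" "i - 2 + 2 = i" using * assms by auto
    with psi_odd[of "i - 2", where 'a='k] * show ?thesis by (simp only: simp_thms)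
  qed
  ultimately show ?thesis by blast
qed

text \<open>
  If \<open>U (i + 1)\<close> is \<open>i\<close>, this is the edge between \<open>U i\<close> and \<open>i\<close>; if it is \<open>U (i - 1)\<close>, it is the edge
  found one step earlier.
\<close>

lemma consecutive_attachment_edge:
  assumes "1 \<le> i" "i \<le> n"
  shows "\<exists>x\<in>edge_set n. psi (var x) = (var (vertex (U i)) * var (vertex (U (i + 1))) :: (nat + nat, 'k::field) mpol)"
  using assms
proof (induction i)
  case (Suc i)
  show ?case
    using attachmentD[OF attachment, of "Suc i + 1"]
  proof
    assume "U (Suc i + 1) = Suc i + 1 - 1"
    with attachment_edge[of "Suc i"] Suc.prems show ?thesis by simp
  next
    assume *: "3 \<le> Suc i + 1 \<and> U (Suc i + 1) = U (Suc i + 1 - 2)"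
    then have "U (Suc i + 1) = U i" "1 \<le> i" by auto
    with Suc show ?thesis by (simp add: mult.commute)
  qed (use Suc.prems in auto)
qed simp

text \<open>
  The 4-cycle through \<open>w_{U i}\<close>, \<open>w_{i+2}\<close>, \<open>w_{i+1}\<close>, \<open>w_i\<close>.
\<close>

lemma square_relation:
  assumes "1 \<le> i" "i \<le> n + 1"
  obtains a where "a \<in> edge_set n"
    "psi (var (2 * i) * var (2 * i + 1)) = (psi (var a * var (2 * i + 2)) :: (nat + nat, 'k::field) mpol)"
proof -
  obtain a where a: "a \<in> edge_set n" "psi (var a) = (var (vertex (U i)) * var (vertex i) :: (nat + nat, 'k) mpol)"
    using attachment_edge[OF assms] by blast
  have e: "psi (var (2 * i + 2)) = (var (vertex (i + 1)) * var (vertex (i + 2)) :: (nat + nat, 'k) mpol)"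
    using psi_even[of "i + 1", where 'a='k] assms by simp
  have i: "i \<le> n + 2" using assms by simp
  show ?thesis
    by (rule that[OF a(1)]) (unfold psi_simps(2) a(2) e psi_even[OF i] psi_odd[OF assms], simp only: mult_ac)
qed

text \<open>
  The 4-cycle through \<open>w_{U i}\<close>, \<open>w_{i+2}\<close>, \<open>w_{i+3}\<close>, \<open>w_{U (i+1)}\<close>.
\<close>

lemma consecutive_relation:
  assumes "1 \<le> i" "i \<le> n"
  obtains a where "a \<in> edge_set n"
    "psi (var (2 * i + 1) * var (2 * i + 3)) = (psi (var a * var (2 * i + 4)) :: (nat + nat, 'k::field) mpol)"
proof -
  obtain a where a: "a \<in> edge_set n"
    "psi (var a) = (var (vertex (U i)) * var (vertex (U (i + 1))) :: (nat + nat, 'k) mpol)"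
    using consecutive_attachment_edge[OF assms] by blast
  have "psi (var (2 * i + 4)) = (var (vertex (i + 2)) * var (vertex (i + 3)) :: (nat + nat, 'k) mpol)"
    using psi_even[of "i + 2", where 'a='k] assms by (simp add: eval_nat_numeral)
  moreover have "psi (var (2 * i + 3)) = (var (vertex (U (i + 1))) * var (vertex (i + 3)) :: (nat + nat, 'k) mpol)"
    using psi_odd[of "i + 1", where 'a='k] assms by (simp add: eval_nat_numeral)
  moreover have "i \<le> n + 1" using assms by simp
  ultimately have "psi (var (2 * i + 1)) * psi (var (2 * i + 3)) =
      (psi (var a) * psi (var (2 * i + 4)) :: (nat + nat, 'k) mpol)"
    unfolding a(2) using psi_odd[of i, where 'a='k] assms(1) by (simp only: mult_ac)
  then show ?thesis by (intro that[OF a(1)]) simp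
qed

lemma lookup_vertex: "Poly_Mapping.lookup (Poly_Mapping.single (vertex i) 1) (vertex k) = of_bool (i = k)"
  by (simp add: lookup_single when_def)

lemma psi_monomial:
  assumes "set_mset M \<subseteq> edge_set n"
  shows "\<exists>e. psi (monomial M) = Poly_Mapping.single e (1::'k::field) \<and>
    (\<forall>k. Poly_Mapping.lookup e (vertex k) = vertex_degree U M k)"
  using assms
proof (induction M)
  case empty
  show ?case by (rule exI[of _ 0]) (simp add: monomial_empty vertex_degree_def)
next
  case (add x M)
  then obtain e where e: "psi (monomial M) = Poly_Mapping.single e (1::'k)"
    "\<And>k. Poly_Mapping.lookup e (vertex k) = vertex_degree U M k" by auto
  define e' where "e' = (if even x then Poly_Mapping.single (vertex (x div 2)) 1 + Poly_Mapping.single (vertex (x div 2 + 1)) (1::nat)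
    else Poly_Mapping.single (vertex (U (x div 2))) 1 + Poly_Mapping.single (vertex (x div 2 + 2)) 1)"
  from add.prems have "x \<in> edge_set n" by simp
  then have "psi (var x) = Poly_Mapping.single e' (1::'k)"
  proof (cases rule: edge_set_cases)
    case (1 i)
    then show ?thesis using psi_even[of i, where 'a='k] by (simp add: e'_def var_def mult_single)
  next
    case (2 i)
    then show ?thesis using psi_odd[of i, where 'a='k] by (simp add: e'_def var_def mult_single)
  qed
  moreover have "Poly_Mapping.lookup e' (vertex k) = edge_incidence U x k" for k
    by (cases "even x") (simp_all only: e'_def edge_incidence_def lookup_add lookup_vertex if_True if_False)
  ultimately show ?case using e
    by (intro exI[of _ "e' + e"]) (simp add: monomial_add_mset mult_single lookup_add vertex_degree_def)
qed

lemma psi_standard_monomial_inj: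
  "inj_on (\<lambda>M. psi (monomial M) :: (nat + nat, 'k::field) mpol) {M. set_mset M \<subseteq> edge_set n \<and> standard M}"
proof (rule inj_onI, clarify)
  fix M M' assume M: "set_mset M \<subseteq> edge_set n" "standard M" and M': "set_mset M' \<subseteq> edge_set n" "standard M'"
    and eq: "psi (monomial M) = (psi (monomial M') :: (nat + nat, 'k) mpol)"
  obtain e where e: "psi (monomial M) = Poly_Mapping.single e (1::'k)"
    "\<And>k. Poly_Mapping.lookup e (vertex k) = vertex_degree U M k"
    using psi_monomial[OF M(1), where 'k='k] by blast
  obtain e' where e': "psi (monomial M') = Poly_Mapping.single e' (1::'k)"
    "\<And>k. Poly_Mapping.lookup e' (vertex k) = vertex_degree U M' k"
    using psi_monomial[OF M'(1), where 'k='k] by blast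
  have "e = e'" using arg_cong[OF eq, of Poly_Mapping.keys] unfolding e(1) e'(1) by simp
  then have "\<And>k. vertex_degree U M k = vertex_degree U M' k" using e(2) e'(2) by metis
  with attachment_less[OF attachment] M M' show "M = M'"
    by (intro standard_eqI[of "n + 1" U]) (auto simp: edge_set_def)
qed

definition parameter :: "nat \<Rightarrow> (nat, 'k::field) mpol" where
  "parameter i = (if i = 0 then var 0 else if i = n + 2 then var (2 * n + 4)
              else var (2 * i) - var (2 * i + 1))"

definition odd_monomial :: "nat set \<Rightarrow> (nat, 'k::field) mpol" where
  "odd_monomial F = (\<Prod>i\<in>F. var (2 * i + 1))"

text \<open>
  A basis element is indexed by a multiset of parameters and a sparse set of odd variables.
\<close>

definition basis_index :: "(nat multiset \<times> nat set) set" where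
  "basis_index = {(A, F). set_mset A \<subseteq> {..n + 2} \<and> sparse (n + 1) F}"

definition index_degree :: "nat multiset \<times> nat set \<Rightarrow> nat" where
  "index_degree = (\<lambda>(A, F). size A + card F)"

definition basis_poly :: "nat multiset \<times> nat set \<Rightarrow> (nat, 'k::field) mpol" where
  "basis_poly = (\<lambda>(A, F). (\<Prod>i\<in>#A. parameter i) * odd_monomial F)"

definition graded_span :: "nat \<Rightarrow> (nat + nat, 'k::field) mpol set" where
  "graded_span d = mp.span ((\<lambda>x. psi (basis_poly x)) ` {x \<in> basis_index. index_degree x = d})"

lemma graded_span_parameter:
  assumes "i \<le> n + 2" "q \<in> graded_span d"
  shows "psi (parameter i) * q \<in> graded_span (Suc d)"
proof -
  have "mp.subspace {q. psi (parameter i) * q \<in> graded_span (Suc d)}"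
    unfolding graded_span_def
    by (rule mp.subspaceI) (auto simp: mp.span_zero distrib_left mult.left_commute
        intro: mp.span_add mp.span_scale)
  moreover have "psi (basis_poly (A, F)) \<in> {q. psi (parameter i) * q \<in> graded_span (Suc d)}"
    if "(A, F) \<in> basis_index" "index_degree (A, F) = d" for A F
  proof -
    have "psi (parameter i) * psi (basis_poly (A, F)) = psi (basis_poly (add_mset i A, F))"
      by (simp add: basis_poly_def mult_ac)
    moreover have "(add_mset i A, F) \<in> {x \<in> basis_index. index_degree x = Suc d}"
      using that assms(1) by (simp add: basis_index_def index_degree_def)
    ultimately show ?thesis by (auto simp: graded_span_def intro!: mp.span_base)
  qed
  ultimately have "graded_span d \<subseteq> {q. psi (parameter i) * q \<in> graded_span (Suc d)}"
    unfolding graded_span_def by (intro mp.span_minimal) auto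
  with assms(2) show ?thesis by blast
qed

lemma graded_span_add: "p \<in> graded_span d \<Longrightarrow> q \<in> graded_span d \<Longrightarrow> p + q \<in> graded_span d"
  and graded_span_diff: "p \<in> graded_span d \<Longrightarrow> q \<in> graded_span d \<Longrightarrow> p - q \<in> graded_span d"
  by (auto simp: graded_span_def intro: mp.span_add mp.span_diff)

text \<open>
  Graded Nakayama, with a rewriting argument inside. The outer induction on the degree disposes of
  multiples of a parameter; the inner induction is on the amount by which the weight of the monomial
  falls short of its maximum in that degree.
\<close>

lemma psi_monomial_in_graded_span:
  assumes "set_mset M \<subseteq> edge_set n" "size M = d"
  shows "psi (monomial M :: (nat, 'k::field) mpol) \<in> graded_span d"
  using assms
proof (induction d arbitrary: M)
  case 0
  have "({#}, {}) \<in> {x \<in> basis_index. index_degree x = 0}" by (simp add: basis_index_def index_degree_def sparse_def)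
  then have "psi (basis_poly ({#}, {}) :: (nat, 'k) mpol) \<in> graded_span 0" 
    unfolding graded_span_def by (intro mp.span_base imageI)
  with 0 show ?case by (simp add: monomial_empty basis_poly_def odd_monomial_def)
next
  case (Suc d)
  define weight where "weight M = (\<Sum>x\<in>#M. 3 ^ x :: nat)" for M
  have weight_le: "weight M \<le> size M * 3 ^ (2 * n + 4)" if "set_mset M \<subseteq> edge_set n" for M
    using that
  proof (induction M)
    case (add x M)
    then have "x \<le> 2 * n + 4" by (auto simp: edge_set_def)
    then have "(3::nat) ^ x \<le> 3 ^ (2 * n + 4)" by (intro power_increasing) auto
    moreover have "weight M \<le> size M * 3 ^ (2 * n + 4)" using add by simp
    ultimately have "3 ^ x + weight M \<le> 3 ^ (2 * n + 4) + size M * 3 ^ (2 * n + 4)"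
      by (rule add_mono)
    then show ?case by (simp add: weight_def)
  qed (simp add: weight_def)
  show ?case using Suc.prems
  proof (induction "Suc d * 3 ^ (2 * n + 4) - weight M" arbitrary: M rule: less_induct)
    case less
    \<comment> \<open>The inner induction hypothesis: it suffices to reach a monomial of larger weight.\<close>
    have step: "psi (monomial M') \<in> (graded_span (Suc d) :: (nat + nat, 'k) mpol set)"
      if "set_mset M' \<subseteq> edge_set n" "size M' = Suc d" "weight M < weight M'" for M'
      using less.hyps[OF _ that(1,2)] weight_le[OF that(1)] that by simp
    have times_parameter: "psi (parameter i * monomial M') \<in> (graded_span (Suc d) :: (nat + nat, 'k) mpol set)"
      if "M' \<subseteq># M" "size M' = d" "i \<le> n + 2" for M' i
      using graded_span_parameter[OF that(3) Suc.IH[OF _ that(2)]] less.prems(1) set_mset_mono[OF that(1)]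
      by auto
    \<comment> \<open>Modulo a multiple of a parameter, even and odd variables may be exchanged.\<close>
    have swap: "psi (var (2 * i) * monomial M') \<in> (graded_span (Suc d) :: (nat + nat, 'k) mpol set) \<longleftrightarrow>
        psi (var (2 * i + 1) * monomial M') \<in> (graded_span (Suc d) :: (nat + nat, 'k) mpol set)"
      if "M' \<subseteq># M" "size M' = d" "1 \<le> i" "i \<le> n + 1" for M' i
    proof -
      have "psi (parameter i * monomial M') = psi (var (2 * i) * monomial M') - (psi (var (2 * i + 1) * monomial M') :: (nat + nat, 'k) mpol)"
        using that by (simp add: parameter_def left_diff_distrib)
      then have "psi (var (2 * i) * monomial M') = psi (parameter i * monomial M') + (psi (var (2 * i + 1) * monomial M') :: (nat + nat, 'k) mpol)"
        "psi (var (2 * i + 1) * monomial M') = psi (var (2 * i) * monomial M') - (psi (parameter i * monomial M') :: (nat + nat, 'k) mpol)"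
        by simp_all
      moreover have "psi (parameter i * monomial M') \<in> (graded_span (Suc d) :: (nat + nat, 'k) mpol set)"
        using times_parameter[OF that(1,2), of i] that(4) by simp
      ultimately show ?thesis by (metis graded_span_add graded_span_diff)
    qed
    show ?case
    proof (cases "\<forall>x\<in>#M. odd x")
      case False
      then obtain x M' where M: "M = add_mset x M'" "even x" by (metis mset_add)
      then obtain i where x: "x = 2 * i" by auto
      with M less.prems have i: "i \<le> n + 2" "size M' = d" using even_in_edge_set[of i n] by auto
      consider "i = 0 \<or> i = n + 2" | "1 \<le> i" "i \<le> n + 1" using i by linarith
      then show ?thesis
      proof cases
        case 1
        then have "parameter i = (var x :: (nat, 'k) mpol)" by (auto simp: parameter_def x eval_nat_numeral)
        with times_parameter[of M' i] M i show ?thesis by (simp add: monomial_add_mset)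
      next
        case 2
        have "2 * i + 1 \<in> edge_set n" using 2 by (simp only: odd_in_edge_set)
        then have "psi (monomial (add_mset (2 * i + 1) M')) \<in> (graded_span (Suc d) :: (nat + nat, 'k) mpol set)"
          using less.prems M x i by (intro step) (auto simp: weight_def)
        then show ?thesis using swap[of M' i] 2 M x i by (simp add: monomial_add_mset)
      qed
    next
      case odd: True
      show ?thesis
      proof (cases "\<exists>i. {#2 * i + 1, 2 * i + 1#} \<subseteq># M")
        case True
        then obtain i K where K: "M = {#2 * i + 1, 2 * i + 1#} + K" by (metis subset_mset.le_iff_add)
        then have "2 * i + 1 \<in> edge_set n" using less.prems by auto
        then have i: "1 \<le> i" "i \<le> n + 1" by (simp_all only: odd_in_edge_set)
        obtain a where a: "a \<in> edge_set n"
          "psi (var (2 * i) * var (2 * i + 1)) = (psi (var a * var (2 * i + 2)) :: (nat + nat, 'k) mpol)"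
          using square_relation[OF i] by blast
        have "psi (monomial ({#a, 2 * i + 2#} + K)) \<in> (graded_span (Suc d) :: (nat + nat, 'k) mpol set)"
          using less.prems K a(1) even_in_edge_set[of "i + 1" n] i
          by (intro step) (auto simp: weight_def)
        also have "psi (monomial ({#a, 2 * i + 2#} + K)) = (psi (var (2 * i) * monomial (add_mset (2 * i + 1) K)) :: (nat + nat, 'k) mpol)"
          using a(2) by (simp add: monomial_add_mset mult.assoc[symmetric])
        finally show ?thesis
          using swap[of "add_mset (2 * i + 1) K" i] K i less.prems(2) by (simp add: monomial_add_mset)
      next
        case no_square: False
        show ?thesis
        proof (cases "\<exists>i. 2 * i + 1 \<in># M \<and> 2 * i + 3 \<in># M")
          case True
          then obtain i where i: "2 * i + 1 \<in># M" "2 * i + 3 \<in># M" by blast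
          then obtain K' where K': "M = add_mset (2 * i + 1) K'" by (metis mset_add)
          with i(2) have "2 * i + 3 \<in># K'" by simp
          then obtain K where "K' = add_mset (2 * i + 3) K" by (metis mset_add)
          with K' have K: "M = {#2 * i + 1, 2 * i + 3#} + K" by simp
          moreover have "2 * i + 3 = 2 * (i + 1) + 1" by simp
          ultimately have "2 * i + 1 \<in> edge_set n" "2 * (i + 1) + 1 \<in> edge_set n"
            using i less.prems by (auto simp only:)
          then have i: "1 \<le> i" "i \<le> n" unfolding odd_in_edge_set by auto
          obtain a where a: "a \<in> edge_set n"
            "psi (var (2 * i + 1) * var (2 * i + 3)) = (psi (var a * var (2 * i + 4)) :: (nat + nat, 'k) mpol)"
            using consecutive_relation[OF i] by blast
          have "2 * i + 4 = 2 * (i + 2)" by simp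
          then have x4: "2 * i + 4 \<in> edge_set n" using i by (simp only: even_in_edge_set)
          have "psi (monomial ({#a, 2 * i + 4#} + K)) \<in> (graded_span (Suc d) :: (nat + nat, 'k) mpol set)"
            using less.prems K a(1) x4 by (intro step) (auto simp: weight_def power_add)
          also have "psi (monomial ({#a, 2 * i + 4#} + K)) = (psi (monomial M) :: (nat + nat, 'k) mpol)"
            using a(2) K by (simp add: monomial_add_mset mult.assoc[symmetric])
          finally show ?thesis .
        next
          case no_consecutive: False
          define F where "F = {i. 2 * i + 1 \<in># M}"
          have "F \<subseteq> {1..n + 1}"
          proof
            fix i assume "i \<in> F"
            then have "2 * i + 1 \<in> edge_set n" using less.prems(1) by (auto simp: F_def)
            then show "i \<in> {1..n + 1}" by (simp only: odd_in_edge_set) simp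
          qed
          moreover have "Suc i \<notin> F" if "i \<in> F" for i
            using that no_consecutive by (auto simp: F_def eval_nat_numeral)
          ultimately have F: "sparse (n + 1) F" "finite F"
            by (auto simp: sparse_def intro: finite_subset)
          have M: "M = image_mset (\<lambda>i. 2 * i + 1) (mset_set F)"
          proof (rule multiset_eqI)
            fix x
            show "count M x = count (image_mset (\<lambda>i. 2 * i + 1) (mset_set F)) x"
            proof (cases "x \<in># M")
              case True
              with odd obtain i where x: "x = 2 * i + 1" by (metis oddE)
              from no_square True x have "count M x < 2"
                by (metis (no_types, lifting) not_less mset_subset_eqI count_le_replicate_mset_subset_eq
                    numeral_2_eq_2 replicate_mset_0 replicate_mset_Suc)
              moreover have "count M x > 0" using True by simp
              ultimately have "count M x = 1" by linarith
              moreover have "i \<in> F" using True x by (simp add: F_def)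
              ultimately show ?thesis using F(2) 
                by (simp add: x image_mset_mset_set inj_on_def)
            next
              case False
              then have "x \<notin># image_mset (\<lambda>i. 2 * i + 1) (mset_set F)"
                using F(2) by (auto simp: F_def)
              with False show ?thesis by (simp only: not_in_iff)
            qed
          qed
          have "({#}, F) \<in> {x \<in> basis_index. index_degree x = Suc d}"
            using F less.prems(2) by (simp add: basis_index_def index_degree_def M)
          then have "psi (basis_poly ({#}, F) :: (nat, 'k) mpol) \<in> graded_span (Suc d)"
            unfolding graded_span_def by (intro mp.span_base imageI)
          moreover have "basis_poly ({#}, F) = (monomial M :: (nat, 'k) mpol)"
            by (simp add: basis_poly_def odd_monomial_def monomial_def M prod_unfold_prod_mset multiset.map_comp comp_def)
          ultimately show ?thesis by simp
        qed
      qed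
    qed
  qed
qed

lemma finite_basis_index: "finite {x \<in> basis_index. index_degree x \<le> D}"
proof (rule finite_subset)
  show "{x \<in> basis_index. index_degree x \<le> D} \<subseteq> (\<Union>k\<le>D. multisets_of_size {..n + 2} k) \<times> Pow {1..n + 1}"
    by (auto simp: basis_index_def index_degree_def sparse_def multisets_of_size_def)
qed (auto intro!: finite_cartesian_product)

lemma standard_of_subset:
  assumes "(A, F) \<in> basis_index"
  shows "set_mset (standard_of (A, F)) \<subseteq> edge_set n"
proof
  have F: "finite F" "F \<subseteq> {1..n + 1}" using assms by (auto simp: basis_index_def sparse_def intro: finite_subset)
  fix x assume x: "x \<in># standard_of (A, F)"
  show "x \<in> edge_set n"
  proof (cases "even x")
    case True
    then obtain i where i: "x = 2 * i" by (rule evenE)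
    with x in_standard_of(2)[OF F(1)] have "i \<in># A" by blast
    with assms have "i \<le> n + 2" by (auto simp: basis_index_def)
    then show ?thesis unfolding i even_in_edge_set .
  next
    case False
    then obtain i where i: "x = 2 * i + 1" by (rule oddE)
    with x in_standard_of(1)[OF F(1)] have "i \<in> F" by blast
    with F(2) show ?thesis unfolding i odd_in_edge_set by auto
  qed
qed

abbreviation basis_image :: "nat multiset \<times> nat set \<Rightarrow> (nat + nat, 'k::field) mpol" where
  "basis_image x \<equiv> psi (basis_poly x)"

text \<open>
  The bound on the degree makes the family finite. The images of the standard monomials are distinct
  monomials, hence independent, there are as many of them as members of the family, and they lie in
  its span.
\<close>

lemma bounded_independent:
  fixes D :: nat
  defines "I \<equiv> {x \<in> basis_index. index_degree x \<le> D}"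
  shows "inj_on (basis_image :: _ \<Rightarrow> (nat + nat, 'k::field) mpol) I"
    "mp.independent ((basis_image :: _ \<Rightarrow> (nat + nat, 'k::field) mpol) ` I)"
proof -
  let ?b = "basis_image :: _ \<Rightarrow> (nat + nat, 'k) mpol"
  \<comment> \<open>The images of the standard monomials, as many as there are members of the family.\<close>
  define s where "s = (\<lambda>x. psi (monomial (standard_of x)) :: (nat + nat, 'k) mpol)"
  have std: "set_mset (standard_of x) \<subseteq> edge_set n" "standard (standard_of x)" "finite (snd x)"
    if "x \<in> I" for x
    using that standard_of_subset[of "fst x" "snd x"] standard_standard_of[of "n + 1" "snd x" "fst x"]
    using sparse_finite[of "n + 1" "snd x"] by (auto simp: I_def basis_index_def)
  have "inj_on s I"
    unfolding s_def
    by (rule comp_inj_on[of standard_of I "\<lambda>M. psi (monomial M)", unfolded comp_def])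
      (use std in \<open>auto intro!: inj_on_subset[OF inj_standard_of] inj_on_subset[OF psi_standard_monomial_inj]\<close>)
  then have "card (s ` I) = card I" by (rule card_image)
  moreover have "mp.independent (s ` I)"
  proof (rule mp.independent_mono)
    show "mp.independent ((\<lambda>m. Poly_Mapping.single m (1::'k)) ` (UNIV :: (nat + nat \<Rightarrow>\<^sub>0 nat) set))"
      by (rule monomials_independent)
    show "s ` I \<subseteq> (\<lambda>m. Poly_Mapping.single m (1::'k)) ` UNIV"
      using psi_monomial[OF std(1), where 'k='k] by (fastforce simp: s_def)
  qed
  moreover have "s ` I \<subseteq> mp.span (?b ` I)"
  proof
    fix y assume "y \<in> s ` I"
    then obtain x where x: "x \<in> I" "y = s x" by blast
    have "size (standard_of x) = index_degree x" by (cases x) (simp add: size_standard_of index_degree_def)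
    with x std have "y \<in> graded_span (index_degree x)"
      unfolding s_def using psi_monomial_in_graded_span by blast
    moreover have "graded_span (index_degree x) \<subseteq> mp.span (?b ` I)"
      unfolding graded_span_def using x(1) by (intro mp.span_mono image_mono) (auto simp: I_def)
    ultimately show "y \<in> mp.span (?b ` I)" by blast
  qed
  moreover have "finite I" unfolding I_def by (rule finite_basis_index)
  ultimately show "inj_on ?b I" "mp.independent (?b ` I)"
    using mp.independent_family_by_counting[of I "s ` I" ?b] by auto
qed

lemma basis_image_inj: "inj_on (basis_image :: _ \<Rightarrow> (nat + nat, 'k::field) mpol) basis_index"
proof (rule inj_onI)
  fix x y assume "x \<in> basis_index" "y \<in> basis_index" "basis_image x = (basis_image y :: (nat + nat, 'k) mpol)"
  then show "x = y"
    using inj_onD[OF bounded_independent(1)[of "max (index_degree x) (index_degree y)", where 'k='k]] by auto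
qed

lemma basis_image_independent: "mp.independent ((basis_image :: _ \<Rightarrow> (nat + nat, 'k::field) mpol) ` basis_index)"
proof -
  let ?b = "basis_image :: _ \<Rightarrow> (nat + nat, 'k) mpol"
  let ?B = "\<lambda>D. ?b ` {x \<in> basis_index. index_degree x \<le> D}"
  have mono: "?B D \<subseteq> ?B D'" if "D \<le> D'" for D D' using that by auto
  have "mp.independent (\<Union>(range ?B))"
  proof (rule mp.independent_Union_directed)
    fix c d assume "c \<in> range ?B" "d \<in> range ?B"
    then obtain D D' where "c = ?B D" "d = ?B D'" by blast
    with mono[of D D'] mono[of D' D] show "c \<subseteq> d \<or> d \<subseteq> c" by (cases "D \<le> D'") auto
  qed (use bounded_independent(2) in auto)
  moreover have "\<Union>(range ?B) = ?b ` basis_index" by auto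
  ultimately show ?thesis by simp
qed

lemma psi_in_graded_span:
  fixes p :: "(nat, 'k::field) mpol"
  assumes "p \<in> carrier (poly_ring (edge_set n))" "homogeneous d p"
  shows "psi p \<in> graded_span d"
proof -
  have "psi (const (Poly_Mapping.lookup p m) * Poly_Mapping.single m 1) \<in> graded_span d"
    if m: "m \<in> Poly_Mapping.keys p" for m
  proof -
    obtain M where M: "Poly_Mapping.single m 1 = (monomial M :: (nat, 'k) mpol)"
      "set_mset M = Poly_Mapping.keys m" "size M = (\<Sum>v\<in>Poly_Mapping.keys m. Poly_Mapping.lookup m v)"
      using single_eq_monomial by blast
    with m assms have "psi (monomial M :: (nat, 'k) mpol) \<in> graded_span d"
      by (intro psi_monomial_in_graded_span) (auto simp: homogeneous_def poly_ring_carrier)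
    then show ?thesis unfolding M(1) by (simp add: graded_span_def mp.span_scale)
  qed
  then show ?thesis
    by (subst mpol_expand) (auto simp: graded_span_def intro!: mp.span_sum)
qed

lemma psi_in_span:
  fixes p :: "(nat, 'k::field) mpol"
  assumes "p \<in> carrier (poly_ring (edge_set n))"
  shows "psi p \<in> mp.span (basis_image ` basis_index)"
proof -
  have "psi (const (Poly_Mapping.lookup p m) * Poly_Mapping.single m 1) \<in> mp.span (basis_image ` basis_index)"
    if m: "m \<in> Poly_Mapping.keys p" for m
  proof -
    obtain M where M: "Poly_Mapping.single m 1 = (monomial M :: (nat, 'k) mpol)"
      "set_mset M = Poly_Mapping.keys m" using single_eq_monomial by blast
    with m assms have "psi (monomial M :: (nat, 'k) mpol) \<in> graded_span (size M)"
      by (intro psi_monomial_in_graded_span) (auto simp: poly_ring_carrier)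
    also have "\<dots> \<subseteq> mp.span (basis_image ` basis_index)"
      unfolding graded_span_def by (intro mp.span_mono) auto
    finally show ?thesis unfolding M(1) by (simp add: mp.span_scale)
  qed
  then show ?thesis
    by (subst mpol_expand) (auto intro!: mp.span_sum)
qed

definition positive_index :: "(nat multiset \<times> nat set) set" where
  "positive_index = {(A, F) \<in> basis_index. A \<noteq> {#}}"

lemma parameter_times_span:
  assumes "set_mset A \<subseteq> {..n + 2}" "A \<noteq> {#}" "q \<in> mp.span (basis_image ` basis_index)"
  shows "psi (\<Prod>i\<in>#A. parameter i) * q \<in> mp.span (basis_image ` positive_index)"
proof -
  have "mp.subspace {q. psi (\<Prod>i\<in>#A. parameter i) * q \<in> mp.span (basis_image ` positive_index)}"
    by (rule mp.subspaceI) (auto simp: mp.span_zero distrib_left mult.left_commute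
        intro: mp.span_add mp.span_scale)
  moreover have "psi (\<Prod>i\<in>#A. parameter i) * basis_image (B, F) \<in> mp.span (basis_image ` positive_index)"
    if "(B, F) \<in> basis_index" for B F
  proof -
    have "psi (\<Prod>i\<in>#A. parameter i) * basis_image (B, F) = basis_image (A + B, F)"
      by (simp add: basis_poly_def mult_ac)
    moreover have "(A + B, F) \<in> positive_index"
      using that assms(1,2) by (simp add: basis_index_def positive_index_def)
    ultimately show ?thesis by (auto intro!: mp.span_base)
  qed
  ultimately have "mp.span (basis_image ` basis_index) \<subseteq>
      {q. psi (\<Prod>i\<in>#A. parameter i) * q \<in> mp.span (basis_image ` positive_index)}"
    by (intro mp.span_minimal) auto
  with assms(3) show ?thesis by blast
qed

lemma parameter_in_carrier: "i \<le> n + 2 \<Longrightarrow> parameter i \<in> carrier (poly_ring (edge_set n))"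
  unfolding parameter_def using even_in_edge_set[of i n] odd_in_edge_set[of i n]
  by (auto intro!: poly_ring_closed var_in_poly_ring simp: edge_set_def)

lemma odd_monomial_in_carrier: "sparse (n + 1) F \<Longrightarrow> odd_monomial F \<in> carrier (poly_ring (edge_set n))"
proof -
  assume "sparse (n + 1) F"
  then have "F \<subseteq> {1..n + 1}" by (simp add: sparse_def)
  then show ?thesis unfolding odd_monomial_def
    by (induction F rule: infinite_finite_induct)
      (auto intro!: poly_ring_closed var_in_poly_ring simp: edge_set_def)
qed

text \<open>
  This is the sum of the toric ideal and the ideal of the parameters, described by the expansion of
  the image of a polynomial in the basis: every basis element that occurs has a parameter as a factor.
  In this form it is clear that no combination of products over sparse sets lies in it.
\<close>

definition parameter_ideal :: "(nat, 'k::field) mpol set" where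
  "parameter_ideal = {p \<in> carrier (poly_ring (edge_set n)). psi p \<in> mp.span (basis_image ` positive_index)}"

text \<open>
  The parameter factor of a basis element absorbs any further factor: the rest is expanded in the
  basis, and multiplying by the parameter again gives basis elements with a parameter as a factor.
\<close>

lemma parameter_ideal_mult:
  assumes "s \<in> carrier (poly_ring (edge_set n))" "p \<in> parameter_ideal"
  shows "s * p \<in> parameter_ideal"
proof -
  have "mp.subspace {q. psi s * q \<in> mp.span (basis_image ` positive_index)}"
    by (rule mp.subspaceI) (auto simp: mp.span_zero distrib_left mult.left_commute
        intro: mp.span_add mp.span_scale)
  moreover have "psi s * basis_image (A, F) \<in> mp.span (basis_image ` positive_index)"
    if "(A, F) \<in> positive_index" for A F
  proof -
    have "psi s * basis_image (A, F) = psi (\<Prod>i\<in>#A. parameter i) * psi (s * odd_monomial F)"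
      by (simp add: basis_poly_def mult_ac)
    moreover have "psi (s * odd_monomial F) \<in> mp.span (basis_image ` basis_index)"
      using that assms(1)
      by (intro psi_in_span poly_ring_closed odd_monomial_in_carrier) (auto simp: positive_index_def basis_index_def)
    ultimately show ?thesis
      using that parameter_times_span[of A "psi (s * odd_monomial F)"] by (simp add: positive_index_def basis_index_def)
  qed
  ultimately have "mp.span (basis_image ` positive_index) \<subseteq>
      {q. psi s * q \<in> mp.span (basis_image ` positive_index)}"
    by (intro mp.span_minimal) auto
  with assms show ?thesis by (auto simp: parameter_ideal_def intro: poly_ring_closed)
qed

section \<open>The quotient by the parameters\<close>

lemma homogeneous_odd_monomial: "finite F \<Longrightarrow> homogeneous (card F) (odd_monomial F)"
proof (induction F rule: finite_induct)
  case empty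
  show ?case using homogeneous_const[of 1] by (simp add: odd_monomial_def)
next
  case (insert i F)
  then show ?case using homogeneous_mult[OF homogeneous_var[of "2 * i + 1"] insert.IH]
    by (simp add: odd_monomial_def)
qed

lemma S_ring_eq: "S_ring n = poly_ring (edge_set n)"
  by (simp add: S_ring_def edge_set_def)

lemma X_seq_eq: "X_seq n = parameter ` {..n + 2}"
proof -
  have "{..n + 2} = insert 0 (insert (n + 2) {1..n + 1})" by auto
  then show ?thesis by (auto simp: X_seq_def parameter_def)
qed

abbreviation toric :: "(nat, 'k::field) mpol set" where "toric \<equiv> toric_ideal (G_graph n t)"

lemma S_cring: "cring (S_ring n :: (nat, 'k::field) mpol ring)"
  unfolding S_ring_eq by (rule poly_ring_cring)

lemma toric_ideal: "ideal (toric :: (nat, 'k::field) mpol set) (S_ring n)"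
  using toric_ideal_is_ideal[OF ends_subset] by (simp add: edges_eq S_ring_eq)

lemma toric_iff: "p \<in> toric \<longleftrightarrow> p \<in> carrier (S_ring n) \<and> psi p = 0"
  by (simp add: toric_ideal_eq edges_eq S_ring_eq)

lemma parameter_ideal_ideal: "ideal (parameter_ideal :: (nat, 'k::field) mpol set) (S_ring n)"
proof -
  interpret cring "S_ring n :: (nat, 'k) mpol ring" by (rule S_cring)
  show ?thesis
  proof (rule idealI[OF ring_axioms])
    show "subgroup (parameter_ideal :: (nat, 'k) mpol set) (add_monoid (S_ring n))"
    proof (rule add.subgroupI)
      show "parameter_ideal \<subseteq> carrier (S_ring n)" by (auto simp: parameter_ideal_def S_ring_eq)
      have "0 \<in> parameter_ideal" by (simp add: parameter_ideal_def poly_ring_closed mp.span_zero)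
      then show "(parameter_ideal :: (nat, 'k) mpol set) \<noteq> {}" by blast
    qed (auto simp: parameter_ideal_def S_ring_eq poly_ring_a_inv poly_ring_closed
          intro: mp.span_neg mp.span_add)
    fix p s :: "(nat, 'k) mpol" assume "p \<in> parameter_ideal" "s \<in> carrier (S_ring n)"
    then have "s * p \<in> parameter_ideal" using parameter_ideal_mult by (simp add: S_ring_eq)
    then show "s \<otimes>\<^bsub>S_ring n\<^esub> p \<in> parameter_ideal" "p \<otimes>\<^bsub>S_ring n\<^esub> s \<in> parameter_ideal"
      by (simp_all add: S_ring_eq mult.commute)
  qed
qed

lemma X_seq_subset: "X_seq n \<subseteq> carrier (S_ring n)"
  unfolding X_seq_eq S_ring_eq using parameter_in_carrier by auto

lemma R_class_hom: "R_class n t \<in> ring_hom (S_ring n :: (nat, 'k::field) mpol ring) (R_ring n t)"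
  using ideal.rcos_ring_hom[OF toric_ideal] by (simp add: R_ring_def R_class_def[abs_def])

lemma R_ring: "ring (R_ring n t :: (nat, 'k::field) mpol set ring)"
  unfolding R_ring_def by (rule ideal.quotient_is_ring[OF toric_ideal])

lemma X_ideal: "ideal (X_ideal n t :: (nat, 'k::field) mpol set set) (R_ring n t)"
  unfolding X_ideal_def
  using X_seq_subset ring_hom_closed[OF R_class_hom]
  by (intro ring.genideal_ideal[OF R_ring]) blast

lemma Rhat_ring: "ring (Rhat n t :: (nat, 'k::field) mpol set set ring)"
  unfolding Rhat_def by (rule ideal.quotient_is_ring[OF X_ideal])

lemma Rhat_class_hom:
  "Rhat_class n t \<in> ring_hom (S_ring n :: (nat, 'k::field) mpol ring) (Rhat n t)"
  using ring_hom_trans[OF R_class_hom ideal.rcos_ring_hom[OF X_ideal]]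
  by (simp add: Rhat_def Rhat_class_def[abs_def] comp_def)

lemma R_class_eq_iff:
  assumes "p \<in> carrier (S_ring n)" "q \<in> carrier (S_ring n)"
  shows "R_class n t p = R_class n t q \<longleftrightarrow> p - q \<in> toric"
proof -
  interpret cring "S_ring n :: (nat, 'a) mpol ring" by (rule S_cring)
  show ?thesis
    using quotient_eq_iff_same_a_r_cos[OF toric_ideal assms] poly_ring_a_minus[of p "edge_set n" q] assms
    by (simp add: R_class_def S_ring_eq)
qed

text \<open>
  The parameters lie in the ideal \<open>parameter_ideal\<close>, whose image in the toric ring is again an
  ideal.
\<close>

lemma X_ideal_subset: "X_ideal n t \<subseteq> R_class n t ` (parameter_ideal :: (nat, 'k::field) mpol set)"
  unfolding X_ideal_def
proof (rule ring.genideal_minimal[OF R_ring])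
  interpret cring "S_ring n :: (nat, 'k) mpol ring" by (rule S_cring)
  show "ideal (R_class n t ` (parameter_ideal :: (nat, 'k) mpol set)) (R_ring n t)"
    using ring_ideal_imp_quot_ideal[OF toric_ideal parameter_ideal_ideal]
    by (simp add: R_ring_def R_class_def[abs_def])
  have "parameter i \<in> (parameter_ideal :: (nat, 'k) mpol set)" if "i \<le> n + 2" for i
  proof -
    have "(add_mset i {#}, {}) \<in> positive_index"
      using that by (simp add: positive_index_def basis_index_def sparse_def)
    moreover have "basis_poly (add_mset i {#}, {}) = (parameter i :: (nat, 'k) mpol)"
      by (simp add: basis_poly_def odd_monomial_def)
    ultimately have "psi (parameter i :: (nat, 'k) mpol) \<in> mp.span (basis_image ` positive_index)"
      by (metis image_eqI mp.span_base)
    with parameter_in_carrier[OF that] show ?thesis by (simp add: parameter_ideal_def)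
  qed
  then show "R_class n t ` X_seq n \<subseteq> R_class n t ` (parameter_ideal :: (nat, 'k) mpol set)"
    unfolding X_seq_eq by auto
qed

text \<open>
  A coset of the quotient by the parameters is represented by a polynomial only up to an element of
  the toric ideal, and the latter maps to zero; so it is enough to follow the difference into
  \<open>parameter_ideal\<close>.
\<close>

lemma Rhat_class_eqD:
  fixes p q :: "(nat, 'k::field) mpol"
  assumes pq: "p \<in> carrier (S_ring n)" "q \<in> carrier (S_ring n)"
    and eq: "Rhat_class n t p = Rhat_class n t q"
  shows "psi (p - q) \<in> mp.span (basis_image ` positive_index)"
proof -
  interpret S: cring "S_ring n :: (nat, 'k) mpol ring" by (rule S_cring)
  interpret R: ring "R_ring n t :: (nat, 'k) mpol set ring" by (rule R_ring)
  interpret h: ring_hom_ring "S_ring n :: (nat, 'k) mpol ring" "R_ring n t" "R_class n t"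
    using R_class_hom by (intro ring_hom_ringI2 S.ring_axioms R.ring_axioms)
  have d: "p - q \<in> carrier (S_ring n)" using pq by (simp add: S_ring_eq poly_ring_closed)
  have "R_class n t p \<ominus>\<^bsub>R_ring n t\<^esub> R_class n t q \<in> X_ideal n t"
    using eq pq R.quotient_eq_iff_same_a_r_cos[OF X_ideal] by (simp add: Rhat_class_def)
  moreover have "R_class n t p \<ominus>\<^bsub>R_ring n t\<^esub> R_class n t q = R_class n t (p - q)"
  proof -
    have "R_class n t (p - q) = R_class n t (p \<ominus>\<^bsub>S_ring n\<^esub> q)"
      using pq poly_ring_a_minus[of p "edge_set n" q] by (simp add: S_ring_eq)
    with pq show ?thesis by (simp only: a_minus_def h.hom_add h.hom_a_inv S.a_inv_closed)
  qed
  ultimately obtain v where v: "v \<in> parameter_ideal" "R_class n t (p - q) = R_class n t v"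
    using X_ideal_subset[where 'k='k] by auto
  then have "v \<in> carrier (S_ring n)" by (simp add: parameter_ideal_def S_ring_eq)
  with d v have "psi (p - q) = psi v" by (simp add: R_class_eq_iff toric_iff)
  with v show ?thesis by (simp add: parameter_ideal_def)
qed

lemma Rhat_class_eqI:
  fixes p q :: "(nat, 'k::field) mpol"
  assumes "p \<in> carrier (S_ring n)" "q \<in> carrier (S_ring n)" "psi p = psi q"
  shows "Rhat_class n t p = Rhat_class n t q"
proof -
  have "p - q \<in> toric" using assms by (simp add: toric_iff S_ring_eq poly_ring_closed)
  with assms show ?thesis using R_class_eq_iff[of p q] by (simp add: Rhat_class_def)
qed

lemma Rhat_class_parameter:
  assumes "i \<le> n + 2"
  shows "Rhat_class n t (parameter i :: (nat, 'k::field) mpol) = \<zero>\<^bsub>Rhat n t\<^esub>"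
proof -
  interpret R: ring "R_ring n t :: (nat, 'k) mpol set ring" by (rule R_ring)
  have mem: "R_class n t (parameter i :: (nat, 'k) mpol) \<in> X_ideal n t"
    unfolding X_ideal_def using X_seq_subset ring_hom_closed[OF R_class_hom] assms
    by (intro subsetD[OF R.genideal_self]) (auto simp: X_seq_eq)
  have "X_ideal n t +>\<^bsub>R_ring n t\<^esub> R_class n t (parameter i :: (nat, 'k) mpol) = X_ideal n t"
    by (rule R.a_coset_join2[OF ideal.Icarr[OF X_ideal mem]
        additive_subgroup.a_subgroup[OF ideal.axioms(1)[OF X_ideal]] mem])
  then show ?thesis by (simp add: Rhat_class_def Rhat_def FactRing_def)
qed

lemma basis_poly_in_carrier: "x \<in> basis_index \<Longrightarrow> basis_poly x \<in> carrier (poly_ring (edge_set n))"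
proof -
  have "(\<Prod>i\<in>#A. parameter i) \<in> carrier (poly_ring (edge_set n))" if "set_mset A \<subseteq> {..n + 2}" for A
    using that by (induction A) (auto simp del: add_2_eq_Suc' intro: poly_ring_closed parameter_in_carrier)
  then show "x \<in> basis_index \<Longrightarrow> basis_poly x \<in> carrier (poly_ring (edge_set n))"
    by (auto simp: basis_poly_def basis_index_def intro!: poly_ring_closed odd_monomial_in_carrier)
qed

lemma Rhat_class_positive:
  assumes "x \<in> positive_index"
  shows "Rhat_class n t (basis_poly x :: (nat, 'k::field) mpol) = \<zero>\<^bsub>Rhat n t\<^esub>"
proof -
  interpret T: ring "Rhat n t :: (nat, 'k) mpol set set ring" by (rule Rhat_ring)
  obtain i A F where x: "x = (add_mset i A, F)" 
    using assms by (auto simp: positive_index_def) (metis multiset_nonemptyE mset_add)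
  then have i: "i \<le> n + 2" "(A, F) \<in> basis_index" using assms by (auto simp: positive_index_def basis_index_def)
  have "basis_poly x = (parameter i * basis_poly (A, F) :: (nat, 'k) mpol)" by (simp add: x basis_poly_def mult.assoc)
  moreover have "(parameter i :: (nat, 'k) mpol) \<in> carrier (S_ring n)"
    "(basis_poly (A, F) :: (nat, 'k) mpol) \<in> carrier (S_ring n)"
    using i by (auto simp: S_ring_eq intro: parameter_in_carrier basis_poly_in_carrier)
  ultimately show ?thesis
    using ring_hom_mult[OF Rhat_class_hom[where 'k='k], of "parameter i" "basis_poly (A, F)"] Rhat_class_parameter[OF i(1), where 'k='k]
      ring_hom_closed[OF Rhat_class_hom[where 'k='k], of "basis_poly (A, F)"]
    by (simp add: S_ring_eq)
qed

definition odd_combinations :: "nat set set \<Rightarrow> (nat, 'k::field) mpol set" where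
  "odd_combinations T = {\<Sum>F\<in>T. const (c F) * odd_monomial F | c. True}"

lemma odd_combinations_in_carrier:
  assumes "T \<subseteq> Collect (sparse (n + 1))" "p \<in> odd_combinations T"
  shows "p \<in> carrier (S_ring n)"
  using assms unfolding S_ring_eq odd_combinations_def
  by (auto intro!: poly_ring_sum poly_ring_closed const_in_poly_ring odd_monomial_in_carrier)

text \<open>
  Otherwise the basis element of \<open>F\<close> would be a combination of the other basis elements, namely those
  of \<open>T\<close> and those with a parameter as a factor.
\<close>

lemma Rhat_class_odd_monomial_notin:
  assumes F: "F \<notin> T" "sparse (n + 1) F" and T: "T \<subseteq> Collect (sparse (n + 1))"
  shows "Rhat_class n t (odd_monomial F :: (nat, 'k::field) mpol) \<notin> Rhat_class n t ` odd_combinations T"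
proof
  assume "Rhat_class n t (odd_monomial F :: (nat, 'k) mpol) \<in> Rhat_class n t ` odd_combinations T"
  then obtain q :: "(nat, 'k) mpol" where q: "q \<in> odd_combinations T" "Rhat_class n t (odd_monomial F) = Rhat_class n t q"
    by blast
  let ?b = "basis_image :: _ \<Rightarrow> (nat + nat, 'k) mpol"
  let ?V = "?b ` (basis_index - {({#}, F)})"
  have odd: "?b ({#}, F') = psi (odd_monomial F')" for F' by (simp add: basis_poly_def)
  have "psi (odd_monomial F - q) \<in> mp.span (?b ` positive_index)"
    using F odd_combinations_in_carrier[OF T q(1)] by (intro Rhat_class_eqD q)
      (simp_all add: S_ring_eq odd_monomial_in_carrier)
  moreover have "mp.span (?b ` positive_index) \<subseteq> mp.span ?V"
    by (intro mp.span_mono image_mono) (auto simp: positive_index_def)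
  moreover have "psi q \<in> mp.span ?V"
  proof -
    from q(1) obtain c where c: "q = (\<Sum>F\<in>T. const (c F) * odd_monomial F)" by (auto simp: odd_combinations_def)
    have "psi (odd_monomial F') \<in> mp.span ?V" if "F' \<in> T" for F'
      unfolding odd[symmetric] using that F T by (intro mp.span_base imageI) (auto simp: basis_index_def)
    then show ?thesis unfolding c by (auto intro!: mp.span_sum mp.span_scale)
  qed
  ultimately have "psi (odd_monomial F - q) + psi q \<in> mp.span ?V" by (intro mp.span_add) auto
  then have "?b ({#}, F) \<in> mp.span ?V" by (simp add: odd)
  moreover have "?V = ?b ` basis_index - {?b ({#}, F)}"
    using basis_image_inj[where 'k='k] F(2) by (subst inj_on_image_set_diff[of ?b basis_index]) (auto simp: basis_index_def)
  moreover have "?b ({#}, F) \<in> ?b ` basis_index" using F(2) by (intro imageI) (simp add: basis_index_def)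
  ultimately have "mp.dependent (?b ` basis_index)" unfolding mp.dependent_def by auto
  with basis_image_independent show False by blast
qed

text \<open>
  The inductive definition of dimension is followed directly: each further sparse set adds one line,
  which is not contained in the space built so far.
\<close>

lemma dimension_odd_combinations:
  assumes "finite T" "T \<subseteq> Collect (sparse (n + 1))"
  shows "ring.dimension (Rhat n t :: (nat, 'k::field) mpol set set ring) (card T)
    (Rhat_scalars n t) (Rhat_class n t ` odd_combinations T)"
  using assms
proof (induction T rule: finite_induct)
  interpret T: ring "Rhat n t :: (nat, 'k) mpol set set ring" by (rule Rhat_ring)
  interpret S: cring "S_ring n :: (nat, 'k) mpol ring" by (rule S_cring)
  note hom = Rhat_class_hom[where 'k='k]
  interpret h: ring_hom_ring "S_ring n :: (nat, 'k) mpol ring" "Rhat n t" "Rhat_class n t"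
    using hom by (intro ring_hom_ringI2 S.ring_axioms T.ring_axioms)
  {
    case empty
    have "Rhat_class n t ` odd_combinations {} = {\<zero>\<^bsub>Rhat n t :: (nat, 'k) mpol set set ring\<^esub>}"
      using h.hom_zero by (simp add: odd_combinations_def S_ring_eq)
    then show ?case using T.zero_dim by simp
  next
    case (insert F T)
    let ?v = "Rhat_class n t (odd_monomial F :: (nat, 'k) mpol)"
    have F: "(odd_monomial F :: (nat, 'k) mpol) \<in> carrier (S_ring n)" "sparse (n + 1) F" and T: "T \<subseteq> Collect (sparse (n + 1))"
      using insert.prems by (auto simp: S_ring_eq odd_monomial_in_carrier)
    have const: "const c \<in> carrier (S_ring n)" for c :: 'k
      by (simp add: S_ring_eq const_in_poly_ring)
    have key: "Rhat_class n t (const c) \<otimes>\<^bsub>Rhat n t\<^esub> ?v \<oplus>\<^bsub>Rhat n t\<^esub> Rhat_class n t q =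
        Rhat_class n t (const c * odd_monomial F + q)" if "q \<in> odd_combinations T" for c :: 'k and q
    proof -
      have "const c * odd_monomial F \<in> carrier (S_ring n)"
        using F(1) const[of c] unfolding S_ring_eq by (intro poly_ring_closed(4))
      from h.hom_add[OF this odd_combinations_in_carrier[OF T that]] h.hom_mult[OF const F(1)]
      show ?thesis by (simp add: S_ring_eq)
    qed
    have "Rhat_class n t ` odd_combinations (insert F T) =
        T.line_extension (Rhat_scalars n t) ?v (Rhat_class n t ` odd_combinations T)"
    proof (intro equalityI subsetI)
      fix y assume "y \<in> Rhat_class n t ` (odd_combinations (insert F T) :: (nat, 'k) mpol set)"
      then obtain c where y: "y = Rhat_class n t (\<Sum>F\<in>insert F T. const (c F) * odd_monomial F :: (nat, 'k) mpol)"
        by (auto simp: odd_combinations_def)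
      let ?q = "\<Sum>F\<in>T. const (c F) * odd_monomial F :: (nat, 'k) mpol"
      have q: "?q \<in> odd_combinations T" by (auto simp: odd_combinations_def)
      have "y = Rhat_class n t (const (c F)) \<otimes>\<^bsub>Rhat n t\<^esub> ?v \<oplus>\<^bsub>Rhat n t\<^esub> Rhat_class n t ?q"
        unfolding key[OF q] y using insert.hyps by simp
      with q show "y \<in> T.line_extension (Rhat_scalars n t) ?v (Rhat_class n t ` odd_combinations T)"
        unfolding T.line_extension_mem_iff Rhat_scalars_def by blast
    next
      fix y assume "y \<in> T.line_extension (Rhat_scalars n t) ?v (Rhat_class n t ` odd_combinations T)"
      then obtain c :: 'k and q where q: "q \<in> odd_combinations T"
        and y: "y = Rhat_class n t (const c) \<otimes>\<^bsub>Rhat n t\<^esub> ?v \<oplus>\<^bsub>Rhat n t\<^esub> Rhat_class n t q"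
        unfolding T.line_extension_mem_iff Rhat_scalars_def by blast
      from q obtain e where e: "q = (\<Sum>F\<in>T. const (e F) * odd_monomial F)" by (auto simp: odd_combinations_def)
      have "(\<Sum>F'\<in>T. const (e F') * odd_monomial F') = (\<Sum>F'\<in>T. const ((e(F := c)) F') * odd_monomial F' :: (nat, 'k) mpol)"
        using insert.hyps by (intro sum.cong) auto
      then have "const c * odd_monomial F + q = (\<Sum>F'\<in>insert F T. const ((e(F := c)) F') * odd_monomial F')"
        using insert.hyps by (simp add: e)
      then have "const c * odd_monomial F + q \<in> odd_combinations (insert F T)" unfolding odd_combinations_def by blast
      then show "y \<in> Rhat_class n t ` odd_combinations (insert F T)" unfolding y key[OF q] by (rule imageI)
    qed
    moreover have "T.dimension (Suc (card T)) (Rhat_scalars n t)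
        (T.line_extension (Rhat_scalars n t) ?v (Rhat_class n t ` odd_combinations T))"
    proof (rule T.Suc_dim)
      show "?v \<in> carrier (Rhat n t)" using F(1) by simp
      show "?v \<notin> Rhat_class n t ` odd_combinations T"
        by (rule Rhat_class_odd_monomial_notin[OF insert.hyps(2) F(2) T])
      show "T.dimension (card T) (Rhat_scalars n t) (Rhat_class n t ` odd_combinations T)"
        using insert.IH T by blast
    qed
    ultimately show ?case using insert.hyps by simp
  }
qed

text \<open>
  The image of a homogeneous polynomial expands in basis elements of its degree; those with a parameter
  as a factor become zero in the quotient.
\<close>

lemma Rhat_piece_eq:
  "(Rhat_piece n t d :: (nat, 'k::field) mpol set set set) =
    Rhat_class n t ` odd_combinations {F. sparse (n + 1) F \<and> card F = d}" (is "_ = _ ` odd_combinations ?T")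
proof (intro equalityI subsetI)
  interpret T: ring "Rhat n t :: (nat, 'k) mpol set set ring" by (rule Rhat_ring)
  interpret S: cring "S_ring n :: (nat, 'k) mpol ring" by (rule S_cring)
  interpret h: ring_hom_ring "S_ring n :: (nat, 'k) mpol ring" "Rhat n t" "Rhat_class n t"
    using Rhat_class_hom by (intro ring_hom_ringI2 S.ring_axioms T.ring_axioms)
  fix y :: "(nat, 'k) mpol set set" assume "y \<in> Rhat_piece n t d"
  then obtain p :: "(nat, 'k) mpol" where p: "p \<in> carrier (S_ring n)" "homogeneous d p" "y = Rhat_class n t p"
    by (auto simp: Rhat_piece_def)
  let ?b = "basis_image :: _ \<Rightarrow> (nat + nat, 'k) mpol"
  let ?I = "{x \<in> basis_index. index_degree x = d}"
  have fin: "finite ?I" by (rule finite_subset[OF _ finite_basis_index[of d]]) auto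
  have "psi p \<in> mp.span (?b ` ?I)"
    using psi_in_graded_span[of p d] p by (simp add: S_ring_eq graded_span_def)
  then obtain u where "psi p = (\<Sum>v\<in>?b ` ?I. const (u v) * v)"
    using fin by (auto simp: mp.span_finite)
  also have "\<dots> = (\<Sum>x\<in>?I. const (u (?b x)) * ?b x)"
    by (subst sum.reindex) (auto intro: inj_on_subset[OF basis_image_inj])
  finally have psi_p: "psi p = (\<Sum>x\<in>?I. const (u (?b x)) * ?b x)" .
  let ?q = "\<lambda>A. \<Sum>x\<in>A. const (u (?b x)) * basis_poly x :: (nat, 'k) mpol"
  let ?Z = "{x \<in> ?I. fst x = {#}}"
  have q_carrier: "?q A \<in> carrier (S_ring n)" if "A \<subseteq> basis_index" for A
    using that unfolding S_ring_eq
    by (intro poly_ring_sum poly_ring_closed const_in_poly_ring basis_poly_in_carrier) auto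
  have pos: "Rhat_class n t (?q A) = \<zero>\<^bsub>Rhat n t\<^esub>" if "finite A" "A \<subseteq> positive_index" for A
    using that
  proof (induction A rule: finite_induct)
    case empty
    then show ?case using h.hom_zero by (simp add: S_ring_eq)
  next
    case (insert x A)
    have x: "x \<in> basis_index" "A \<subseteq> basis_index" using insert.prems by (auto simp: positive_index_def)
    let ?c = "const (u (?b x)) :: (nat, 'k) mpol"
    have carr: "?c \<in> carrier (S_ring n)" "basis_poly x \<in> carrier (S_ring n)" "?q A \<in> carrier (S_ring n)"
      "?c * basis_poly x \<in> carrier (S_ring n)"
      using basis_poly_in_carrier[OF x(1)] q_carrier[OF x(2)]
      by (auto simp: S_ring_eq const_in_poly_ring intro: poly_ring_closed)
    have "Rhat_class n t (?c * basis_poly x + ?q A) =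
        Rhat_class n t ?c \<otimes>\<^bsub>Rhat n t\<^esub> Rhat_class n t (basis_poly x) \<oplus>\<^bsub>Rhat n t\<^esub> Rhat_class n t (?q A)"
      using h.hom_add[OF carr(4,3)] h.hom_mult[OF carr(1,2)] by (simp add: S_ring_eq)
    also have "\<dots> = \<zero>\<^bsub>Rhat n t\<^esub>"
      using insert Rhat_class_positive[of x, where 'k='k] carr(1) by simp
    finally show ?case using insert.hyps by simp
  qed
  have "?I - ?Z \<subseteq> positive_index" by (auto simp: positive_index_def)
  then have zero: "Rhat_class n t (?q (?I - ?Z)) = \<zero>\<^bsub>Rhat n t\<^esub>"
    using fin by (intro pos finite_Diff)
  have Z: "?Z = Pair {#} ` ?T" by (auto simp: basis_index_def index_degree_def)
  have "y = Rhat_class n t (?q ?I)"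
    unfolding p(3) using p(1) q_carrier[of ?I] by (intro Rhat_class_eqI) (auto simp: psi_p)
  also have "?q ?I = ?q ?Z + ?q (?I - ?Z)"
    using fin by (subst sum.subset_diff[of ?Z]) (auto simp: add.commute)
  also have "Rhat_class n t \<dots> = Rhat_class n t (?q ?Z)"
  proof -
    have qZ: "?q ?Z \<in> carrier (S_ring n)" and qP: "?q (?I - ?Z) \<in> carrier (S_ring n)"
      by (rule q_carrier, blast)+
    have "?q ?Z + ?q (?I - ?Z) = ?q ?Z \<oplus>\<^bsub>S_ring n\<^esub> ?q (?I - ?Z)" by (simp only: S_ring_eq poly_ring_simps)
    then show ?thesis using h.hom_add[OF qZ qP] h.hom_closed[OF qZ] by (simp only: zero T.r_zero)
  qed
  also have "?q ?Z = (\<Sum>F\<in>?T. const (u (?b ({#}, F))) * odd_monomial F)"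
    unfolding Z by (subst sum.reindex) (auto simp: inj_on_def basis_poly_def)
  finally show "y \<in> Rhat_class n t ` odd_combinations ?T"
    by (auto simp: odd_combinations_def)
next
  fix y :: "(nat, 'k) mpol set set" assume "y \<in> Rhat_class n t ` odd_combinations ?T"
  then obtain q :: "(nat, 'k) mpol" where q: "q \<in> odd_combinations ?T" "y = Rhat_class n t q" by blast
  have "q \<in> carrier (S_ring n)" using q(1) by (intro odd_combinations_in_carrier[of ?T]) auto
  moreover have "homogeneous d (const c * odd_monomial F :: (nat, 'k) mpol)" if "F \<in> ?T" for c F
    using that homogeneous_mult[OF homogeneous_const homogeneous_odd_monomial[OF sparse_finite]] by auto
  then have "homogeneous d q" using q(1) by (auto simp: odd_combinations_def intro!: homogeneous_sum)
  ultimately show "y \<in> Rhat_piece n t d" using q(2) by (auto simp: Rhat_piece_def)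
qed

theorem dimension_Rhat_piece:
  "ring.dimension (Rhat n t :: (nat, 'k::field) mpol set set ring) ((n + 2 - i) choose i)
    (Rhat_scalars n t) (Rhat_piece n t i)"
proof -
  have "finite {F. sparse (n + 1) F \<and> card F = i}"
    by (rule finite_subset[of _ "Pow {1..n + 1}"]) (auto simp: sparse_def)
  from dimension_odd_combinations[OF this, where 'k='k] show ?thesis
    unfolding Rhat_piece_eq card_sparse_subsets by auto
qed

end

section \<open>The Hilbert function\<close>

text \<open>
  The bound on \<open>i\<close> makes \<open>n + 2 - i\<close> an honest difference; if \<open>2 i > n + 2\<close>, both sides vanish.
\<close>

lemma choose_as_product:
  assumes "i \<le> n + 2"
  shows "real ((n + 2 - i) choose i) = 1 / fact i * (\<Prod>j = 1..i. real n + real j - 2 * (real i - 1))"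
proof -
  have "real ((n + 2 - i) choose i) = (\<Prod>k = 0..<i. real (n + 2 - i) - real k) / fact i"
    by (simp add: binomial_gbinomial gbinomial_prod_rev)
  also have "(\<Prod>k = 0..<i. real (n + 2 - i) - real k) =
      (\<Prod>j = 1..i. real n + real j - 2 * (real i - 1))"
    by (rule prod.reindex_bij_witness[of _ "\<lambda>j. i - j" "\<lambda>k. i - k"])
      (use assms in \<open>auto simp: of_nat_diff\<close>)
  finally show ?thesis by simp
qed

theorem theorem1p4:
  fixes n :: nat and t :: "bit list"
  assumes "length t = n + 1"
  shows "(\<forall>i \<le> n + 2. \<exists>d. ring.dimension (Rhat n t :: (nat, 'k::field) mpol set set ring) d
              (Rhat_scalars n t) (Rhat_piece n t i) \<and>
            real d = (if i = 0 then 1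
                      else 1 / fact i * (\<Prod>j = 1..i. real n + real j - 2 * (real i - 1)))) \<and>
         (\<forall>i. real i > real n / 2 + 1 \<longrightarrow>
            ring.dimension (Rhat n t :: (nat, 'k) mpol set set ring) 0
              (Rhat_scalars n t) (Rhat_piece n t i))"
proof -
  obtain U where "attachment n U" "\<And>p x. ladder n t p = Some x \<longleftrightarrow> x \<in> edge_set n \<and> cell U x = p"
    using ladder_cell by blast
  then interpret ladder_graph n t U by unfold_locales
  show ?thesis
  proof (intro conjI allI impI)
    fix i assume i: "i \<le> n + 2"
    have "real ((n + 2 - i) choose i) = (if i = 0 then 1
        else 1 / fact i * (\<Prod>j = 1..i. real n + real j - 2 * (real i - 1)))"
      using choose_as_product[OF i] by (cases "i = 0") simp_all
    then show "\<exists>d. ring.dimension (Rhat n t :: (nat, 'k) mpol set set ring) d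
              (Rhat_scalars n t) (Rhat_piece n t i) \<and>
            real d = (if i = 0 then 1
                      else 1 / fact i * (\<Prod>j = 1..i. real n + real j - 2 * (real i - 1)))"
      using dimension_Rhat_piece by blast
  next
    fix i assume "real i > real n / 2 + 1"
    then have "n + 2 - i < i" by linarith
    then have none: "(n + 2 - i) choose i = 0" by (rule binomial_eq_0)
    show "ring.dimension (Rhat n t :: (nat, 'k) mpol set set ring) 0
              (Rhat_scalars n t) (Rhat_piece n t i)"
      using dimension_Rhat_piece[of i, where 'k='k] unfolding none .
  qed
qed

end
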